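(* For every integer $d\geq 3$, $$\lim_{n\to\infty}\frac{W_d(n)}{n^2}=\lim_{n\to\infty}\frac{U_d(n)}{n^2}=\lim_{n\to\infty}\frac{D_d(n)}{n^2}=\frac12\left(1-\frac{1}{a(d)}\right)$$ (in particular, all three limits exist).
   Context: A norm on $\mathbf{R}^d$ is strictly convex if its unit sphere contains no nondegenerate line segment. In the following, pairs are unordered pairs of distinct points and the maxima are over all sets of $n$ points in $\mathbf{R}^d$ and all strictly convex norms on $\mathbf{R}^d$. $W_d(n)$: the maximum number of pairwise nonparallel segments of unit length (in the norm) with both endpoints in the set of $n$ points. $U_d(n)$: the maximum number of unit distance pairs (pairs at norm-distance $1$) in the set of $n$ points. $D_d(n)$: the maximum number of diameter pairs in the set of $n$ points, where a diameter pair is a pair of points of the set whose distance equals the diameter of the set (in the norm). A family $\{A_i: i\in I\}$ of sets of points in $\mathbf{R}^d$ is strictly antipodal if for any $i,j\in I$ with $i\neq j$, and any $p\in A_i$, $q\in A_j$, there is a linear functional $\varphi:\mathbf{R}^d\to\mathbf{R}$ such that $\varphi(p)<\varphi(r)<\varphi(q)$ for every $r\in\left(\bigcup_{k\in I}A_k\right)\setminus\{p,q\}$. $a(d)$: the largest $k$ such that for each positive integer $m$ there exists a strictly antipodal family of $k$ sets in $\mathbf{R}^d$, each of size at least $m$. (It is known that $a(d)<2^d$, so $a(d)$ is finite.) *)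

theory Defs
  imports "HOL-Analysis.Analysis"
begin

definition is_norm :: "('a::real_vector \<Rightarrow> real) \<Rightarrow> bool" where
  "is_norm N \<longleftrightarrow>
     (\<forall>x. 0 \<le> N x) \<and> (\<forall>x. N x = 0 \<longleftrightarrow> x = 0) \<and>
     (\<forall>c x. N (c *\<^sub>R x) = \<bar>c\<bar> * N x) \<and>
     (\<forall>x y. N (x + y) \<le> N x + N y)"

definition strictly_convex_norm :: "('a::real_vector \<Rightarrow> real) \<Rightarrow> bool" where
  "strictly_convex_norm N \<longleftrightarrow>
     is_norm N \<and> \<not> (\<exists>x y. x \<noteq> y \<and> closed_segment x y \<subseteq> {z. N z = 1})"

definition unit_pairs :: "('a::real_vector \<Rightarrow> real) \<Rightarrow> 'a set \<Rightarrow> 'a set set" where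
  "unit_pairs N S = {{x, y} | x y. x \<in> S \<and> y \<in> S \<and> x \<noteq> y \<and> N (x - y) = 1}"

text \<open>The analogue of \<^const>\<open>diameter\<close> for the metric induced by \<open>N\<close>.\<close>

definition norm_diameter :: "('a::real_vector \<Rightarrow> real) \<Rightarrow> 'a set \<Rightarrow> real" where
  "norm_diameter N S = (if S = {} then 0 else SUP (x, y) \<in> S \<times> S. N (x - y))"

definition diameter_pairs :: "('a::real_vector \<Rightarrow> real) \<Rightarrow> 'a set \<Rightarrow> 'a set set" where
  "diameter_pairs N S =
     {{x, y} | x y. x \<in> S \<and> y \<in> S \<and> x \<noteq> y \<and> N (x - y) = norm_diameter N S}"

text \<open>A segment is represented by its pair of endpoints; the relation is only used for pairs
  of distinct points, where it depends neither on the order of the endpoints nor on the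
  order of the two segments.\<close>

definition parallel :: "'a::real_vector set \<Rightarrow> 'a set \<Rightarrow> bool" where
  "parallel e f \<longleftrightarrow> (\<exists>a b c d t. e = {a, b} \<and> f = {c, d} \<and> d - c = t *\<^sub>R (b - a))"

text \<open>In the next three definitions all candidate values are at most \<open>n choose 2\<close>, so
  \<^const>\<open>Max\<close> is taken over a finite set.  The dimension is \<open>CARD('d)\<close>.\<close>

definition max_nonparallel_unit_segments :: "'d::finite itself \<Rightarrow> nat \<Rightarrow> nat" where
  "max_nonparallel_unit_segments _ n =
     Max {card E | (N :: real ^ 'd \<Rightarrow> real) S E.
            strictly_convex_norm N \<and> finite S \<and> card S = n \<and>
            E \<subseteq> unit_pairs N S \<and> pairwise (\<lambda>e f. \<not> parallel e f) E}"

definition max_unit_pairs :: "'d::finite itself \<Rightarrow> nat \<Rightarrow> nat" where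
  "max_unit_pairs _ n =
     Max {card (unit_pairs N S) | (N :: real ^ 'd \<Rightarrow> real) S.
            strictly_convex_norm N \<and> finite S \<and> card S = n}"

definition max_diameter_pairs :: "'d::finite itself \<Rightarrow> nat \<Rightarrow> nat" where
  "max_diameter_pairs _ n =
     Max {card (diameter_pairs N S) | (N :: real ^ 'd \<Rightarrow> real) S.
            strictly_convex_norm N \<and> finite S \<and> card S = n}"

definition strictly_antipodal :: "'i set \<Rightarrow> ('i \<Rightarrow> 'a::real_vector set) \<Rightarrow> bool" where
  "strictly_antipodal I A \<longleftrightarrow>
     (\<forall>i\<in>I. \<forall>j\<in>I. i \<noteq> j \<longrightarrow> (\<forall>p\<in>A i. \<forall>q\<in>A j.
        \<exists>\<phi> :: 'a \<Rightarrow> real. linear \<phi> \<and>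
          (\<forall>r \<in> (\<Union>k\<in>I. A k) - {p, q}. \<phi> p < \<phi> r \<and> \<phi> r < \<phi> q)))"

text \<open>The disjunct \<^term>\<open>infinite (A i)\<close> is needed because the cardinality
  function \<^const>\<open>card\<close> is \<open>0\<close> on infinite sets.\<close>

definition antipodal_number :: "'d::finite itself \<Rightarrow> nat" where
  "antipodal_number _ =
     (GREATEST k. \<forall>m>0. \<exists>A :: nat \<Rightarrow> (real ^ 'd) set.
        strictly_antipodal {..<k} A \<and> (\<forall>i<k. infinite (A i) \<or> m \<le> card (A i)))"

end

theory Submission
  imports Defs
begin

text \<open>A strictly convex norm has at every unit vector \<open>v\<close> a supporting functional that attains its
  maximum over the unit ball only at \<open>v\<close>.  Hence sets with all cross distances equal to \<open>1\<close> and all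
  other distances at most \<open>1\<close> form a strictly antipodal family, and in a set of diameter \<open>1\<close> no two
  diameters are parallel, so that \<open>D \<le> W \<le> U\<close> after rescaling.

  For the upper bound on \<open>U\<close>, a unit distance graph with more than
  \<open>(1 - 1 / k + \<epsilon>) * n\<^sup>2 / 2\<close> edges contains a large complete \<open>(k + 1)\<close>-partite graph by the
  Erdos--Stone theorem.  A packing bound independent of the norm makes the parts have diameter at
  most \<open>1\<close>, at the cost of a constant factor in their size, so they are strictly antipodal and \<open>k + 1\<close> is at most
  \<open>a(d)\<close>.  For the lower bound on \<open>D\<close>, the differences between different members of a
  strictly antipodal family are exposed among all differences, and there is a strictly convex norm
  in which these all have length \<open>1\<close> and no difference is longer.\<close>

subsection \<open>Graphs without large complete multipartite subgraphs\<close>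

text \<open>Both \<open>unit_pairs\<close> and \<open>diameter_pairs\<close> have this form, so the
  counting bounds below apply to each of them.\<close>

definition edge_pairs :: "('a \<Rightarrow> 'a \<Rightarrow> bool) \<Rightarrow> 'a set \<Rightarrow> 'a set set" where
  "edge_pairs E S = {{x, y} | x y. x \<in> S \<and> y \<in> S \<and> x \<noteq> y \<and> E x y}"

lemma edge_pairs_subset: "edge_pairs E S \<subseteq> {e. e \<subseteq> S \<and> card e = 2}"
  unfolding edge_pairs_def by auto

lemma finite_edge_pairs: "finite S \<Longrightarrow> finite (edge_pairs E S)"
  by (rule finite_subset[OF edge_pairs_subset]) (auto intro: finite_subset[of _ "Pow S"])

lemma card_edge_pairs_le_choose:
  assumes "finite S"
  shows "card (edge_pairs E S) \<le> card S choose 2"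
proof -
  have "finite {e. e \<subseteq> S \<and> card e = 2}" using assms by simp
  then have "card (edge_pairs E S) \<le> card {e. e \<subseteq> S \<and> card e = 2}"
    using edge_pairs_subset by (rule card_mono)
  then show ?thesis using n_subsets[OF assms, of 2] by simp
qed

lemma choose_two_le_square: "n choose 2 \<le> n\<^sup>2"
proof -
  have "n choose 2 \<le> n * (n - 1)" unfolding choose_two by (rule div_le_dividend)
  also have "\<dots> \<le> n * n" by simp
  finally show ?thesis by (simp add: power2_eq_square)
qed

lemma card_edge_pairs_insert_le:
  assumes "finite S" "symp E"
  shows "card (edge_pairs E (insert v S)) \<le> card (edge_pairs E S) + card {u \<in> S. E v u}"
proof -
  have "edge_pairs E (insert v S) \<subseteq> edge_pairs E S \<union> (\<lambda>u. {v, u}) ` {u \<in> S. E v u}"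
    using assms(2) unfolding edge_pairs_def by (auto dest: sympD)
  then have "card (edge_pairs E (insert v S))
      \<le> card (edge_pairs E S \<union> (\<lambda>u. {v, u}) ` {u \<in> S. E v u})"
    using assms(1) by (intro card_mono) (auto simp: finite_edge_pairs)
  also have "\<dots> \<le> card (edge_pairs E S) + card ((\<lambda>u. {v, u}) ` {u \<in> S. E v u})"
    by (rule card_Un_le)
  also have "\<dots> \<le> card (edge_pairs E S) + card {u \<in> S. E v u}"
    using assms(1) by (simp add: card_image_le)
  finally show ?thesis .
qed

text \<open>Delete a vertex of small degree again and again until at most \<open>s\<close> vertices
  remain. The deleted degrees add up to at most \<open>\<alpha> * (1 + ... + card S)\<close>, and
  the remaining vertices span at most \<open>s ^ 2\<close> edges. This turns a degree condition on
  all large subsets into an edge bound.\<close>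

lemma card_edge_pairs_le_of_small_degrees:
  fixes \<alpha> :: real
  assumes "finite S" "symp E" "0 \<le> \<alpha>"
    and "\<And>V. V \<subseteq> S \<Longrightarrow> s < card V \<Longrightarrow> \<exists>v\<in>V. real (card {u \<in> V. E v u}) \<le> \<alpha> * real (card V)"
  shows "real (card (edge_pairs E S)) \<le> real s ^ 2 + \<alpha> * real (card S) * (real (card S) + 1) / 2"
  using assms(1,4)
proof (induction S rule: finite_psubset_induct)
  case (psubset S)
  show ?case
  proof (cases "s < card S")
    case False
    have "card (edge_pairs E S) \<le> card S choose 2"
      using psubset by (simp add: card_edge_pairs_le_choose)
    also have "\<dots> \<le> card S ^ 2"
      by (rule choose_two_le_square)
    also have "\<dots> \<le> s ^ 2"
      using False by (simp add: power_mono)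
    finally have "real (card (edge_pairs E S)) \<le> real (s ^ 2)"
      by (rule of_nat_mono)
    then show ?thesis using assms(3)
      by (simp add: add_increasing2)
  next
    case True
    then obtain v where v: "v \<in> S" "real (card {u \<in> S. E v u}) \<le> \<alpha> * real (card S)"
      using psubset.prems by blast
    let ?S = "S - {v}"
    have cS: "real (card ?S) = real (card S) - 1"
      using v(1) psubset(1) by (metis One_nat_def card.remove finite of_nat_Suc add_diff_cancel_right'
          add.commute)
    have IH: "real (card (edge_pairs E ?S))
        \<le> real s ^ 2 + \<alpha> * real (card ?S) * (real (card ?S) + 1) / 2"
    proof (rule psubset.IH)
      show "?S \<subset> S" using v(1) by blast
      show "\<exists>v\<in>V. real (card {u \<in> V. E v u}) \<le> \<alpha> * real (card V)"
        if "V \<subseteq> ?S" "s < card V" for V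
        using that by (intro psubset.prems) auto
    qed
    have "card {u \<in> ?S. E v u} \<le> card {u \<in> S. E v u}"
      using psubset(1) by (intro card_mono) auto
    moreover have "card (edge_pairs E S) \<le> card (edge_pairs E ?S) + card {u \<in> ?S. E v u}"
      using card_edge_pairs_insert_le[of ?S E v] v(1) psubset(1) assms(2) by (simp add: insert_absorb)
    ultimately have "card (edge_pairs E S) \<le> card (edge_pairs E ?S) + card {u \<in> S. E v u}"
      by linarith
    then have "real (card (edge_pairs E S))
        \<le> real (card (edge_pairs E ?S)) + real (card {u \<in> S. E v u})"
      unfolding of_nat_add[symmetric] by (rule of_nat_mono)
    also have "\<dots> \<le> (real s ^ 2 + \<alpha> * real (card ?S) * (real (card ?S) + 1) / 2)
        + \<alpha> * real (card S)"
      using IH v(2) by (rule add_mono)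
    also have "\<dots> = real s ^ 2 + \<alpha> * real (card S) * (real (card S) + 1) / 2"
    proof -
      have "a + \<alpha> * (c - 1) * ((c - 1) + 1) / 2 + \<alpha> * c = a + \<alpha> * c * (c + 1) / 2" for a c :: real
        by (simp add: field_simps)
      then show ?thesis unfolding cS .
    qed
    finally show ?thesis .
  qed
qed

section \<open>The Erdos-Stone theorem in minimum-degree form\<close>

lemma pigeonhole_fibre:
  assumes "finite A" "f ` A \<subseteq> T" "finite T" "card T * t < card A"
  shows "\<exists>y\<in>T. t \<le> card {x \<in> A. f x = y}"
proof (rule ccontr)
  assume "\<not> ?thesis"
  then have *: "card {x \<in> A. f x = y} \<le> t" if "y \<in> T" for y
    using that by force
  have "card A = (\<Sum>y\<in>T. card {x \<in> A. f x = y})"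
    using sum_fun_comp[OF assms(1,3,2), of "\<lambda>_. 1::nat"] by simp
  also have "\<dots> \<le> card T * t"
    using sum_bounded_above[of T "\<lambda>y. card {x \<in> A. f x = y}" t] * by simp
  finally show False using assms(4) by simp
qed

text \<open>Edges inside a part are allowed. For an irreflexive relation, such as unit distance, the
  parts are automatically disjoint.\<close>

definition has_complete_multipartite ::
    "('a \<Rightarrow> 'a \<Rightarrow> bool) \<Rightarrow> 'a set \<Rightarrow> nat \<Rightarrow> nat \<Rightarrow> bool" where
  "has_complete_multipartite E V r t \<longleftrightarrow>
     (\<exists>B :: nat \<Rightarrow> 'a set. (\<forall>i<r. B i \<subseteq> V \<and> t \<le> card (B i)) \<and>
        (\<forall>i<r. \<forall>j<r. i \<noteq> j \<longrightarrow> (\<forall>x\<in>B i. \<forall>y\<in>B j. E x y)))"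

text \<open>Erdos--Stone in minimum-degree form.  Given \<open>r + 1\<close> parts of a large size \<open>T\<close>, a positive
  proportion of all vertices has at least \<open>t\<close> neighbours in each part, and \<open>t\<close> of these vertices with the
  same neighbourhood in the parts form the next part.\<close>

lemma complete_multipartite_of_large_degrees:
  fixes \<epsilon> :: real
  assumes "0 < \<epsilon>"
  shows "\<exists>n0. \<forall>(V :: 'a set) E. finite V \<longrightarrow> n0 \<le> card V \<longrightarrow> symp E \<longrightarrow>
    (\<forall>v\<in>V. real r * real (card {u \<in> V. \<not> E v u}) \<le> (1 - \<epsilon>) * real (card V)) \<longrightarrow>
    has_complete_multipartite E V (Suc r) t"
proof (induction r arbitrary: t)
  case 0
  have "has_complete_multipartite E V (Suc 0) t" if "t \<le> card V" for E and V :: "'a set"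
    unfolding has_complete_multipartite_def by (rule exI[of _ "\<lambda>_. V"]) (use that in auto)
  then show ?case by blast
next
  case (Suc r)
  \<comment> \<open>A vertex with fewer than \<open>t\<close> neighbours in some part misses more
    than \<open>T - t\<close> of its points, and this choice makes
    \<open>T - t \<ge> (1 - \<epsilon> / 2) * T\<close>. The summand 1 keeps \<open>T\<close>
    positive when \<open>t = 0\<close>.\<close>
  define T where "T = nat \<lceil>2 * real t / \<epsilon>\<rceil> + 1"
  have T: "2 * real t \<le> \<epsilon> * real T" "0 < T"
  proof -
    have "2 * real t / \<epsilon> \<le> real T" unfolding T_def by linarith
    then show "2 * real t \<le> \<epsilon> * real T" using assms by (simp add: field_simps)
  qed (simp add: T_def)
  obtain n1 where n1: "\<forall>(V :: 'a set) E. finite V \<longrightarrow> n1 \<le> card V \<longrightarrow> symp E \<longrightarrow>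
    (\<forall>v\<in>V. real r * real (card {u \<in> V. \<not> E v u}) \<le> (1 - \<epsilon>) * real (card V)) \<longrightarrow>
    has_complete_multipartite E V (Suc r) T"
    using Suc.IH[of T] ..
  \<comment> \<open>\<open>2 ^ (Suc r * T)\<close> bounds the number of possible neighbourhoods
    within the union of \<open>Suc r\<close> parts of size \<open>T\<close>, so more than
    \<open>M\<close> vertices include \<open>t\<close> with the same one. The size \<open>n0\<close>
    makes \<open>\<epsilon> / 2 * card V\<close> exceed \<open>M\<close>.\<close>
  define M where "M = 2 ^ (Suc r * T) * t"
  define n0 where "n0 = max n1 (nat \<lceil>2 * real M / \<epsilon>\<rceil> + 1)"
  show ?case
  proof (intro exI[of _ n0] allI impI)
    fix V :: "'a set" and E
    assume V: "finite V" "n0 \<le> card V" "symp E"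
      and deg: "\<forall>v\<in>V. real (Suc r) * real (card {u \<in> V. \<not> E v u}) \<le> (1 - \<epsilon>) * real (card V)"
    let ?n = "real (card V)"
    have deg_r: "real r * real (card {u \<in> V. \<not> E v u}) \<le> (1 - \<epsilon>) * ?n" if "v \<in> V" for v
      using deg[rule_format, OF that] by (rule order_trans[rotated]) (simp add: algebra_simps)
    have "n1 \<le> card V" using V(2) unfolding n0_def by simp
    then have "has_complete_multipartite E V (Suc r) T"
      using n1 V(1,3) deg_r by simp
    then obtain B0 :: "nat \<Rightarrow> 'a set" where B0: "\<And>i. i \<le> r \<Longrightarrow> B0 i \<subseteq> V" "\<And>i. i \<le> r \<Longrightarrow> T \<le> card (B0 i)"
      "\<And>i j x y. i \<le> r \<Longrightarrow> j \<le> r \<Longrightarrow> i \<noteq> j \<Longrightarrow> x \<in> B0 i \<Longrightarrow> y \<in> B0 j \<Longrightarrow> E x y"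
      unfolding has_complete_multipartite_def less_Suc_eq_le by metis
    have "\<exists>X. X \<subseteq> B0 i \<and> card X = T \<and> finite X" if "i \<le> r" for i
      using B0(2)[OF that] by (meson obtain_subset_with_card_n)
    then obtain B where B: "\<And>i. i \<le> r \<Longrightarrow> B i \<subseteq> B0 i" "\<And>i. i \<le> r \<Longrightarrow> card (B i) = T"
      "\<And>i. i \<le> r \<Longrightarrow> finite (B i)"
      by metis
    define W where "W = (\<Union>i\<le>r. B i)"
    have W: "finite W" "W \<subseteq> V" using B B0 unfolding W_def by blast+
    have cW: "card W \<le> Suc r * T"
      unfolding W_def using card_UN_le[of "{..r}" B] B(2) by simp
    define bad where "bad = {u \<in> V. \<exists>i\<le>r. card {b \<in> B i. E b u} < t}"
    have bad: "real T - real t \<le> real (card {b \<in> W. \<not> E b u})" if "u \<in> bad" for u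
    proof -
      obtain i where i: "i \<le> r" "card {b \<in> B i. E b u} < t"
        using \<open>u \<in> bad\<close> unfolding bad_def by blast
      have "T = card {b \<in> B i. E b u} + card {b \<in> B i. \<not> E b u}"
        using card_Int_Diff[of "B i" "{b. E b u}"] B(2,3)[OF i(1)]
        by (simp add: Int_def set_diff_eq)
      moreover have "card {b \<in> B i. \<not> E b u} \<le> card {b \<in> W. \<not> E b u}"
        using W(1) i(1) by (intro card_mono) (auto simp: W_def)
      ultimately show ?thesis using i(2) by linarith
    qed
    \<comment> \<open>Double counting of non-adjacent pairs between \<open>bad\<close> and
      \<open>W\<close>: every bad vertex misses at least \<open>T - t\<close> vertices of
      \<open>W\<close>, while each vertex of \<open>W\<close> misses at most
      \<open>(1 - \<epsilon>) * card V / Suc r\<close> vertices of \<open>V\<close>.\<close>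
    have "(real T - real t) * real (card bad) = (\<Sum>u\<in>bad. real T - real t)"
      by simp
    also have "\<dots> \<le> (\<Sum>u\<in>bad. real (card {b \<in> W. \<not> E b u}))"
      by (rule sum_mono) (rule bad)
    also have "\<dots> \<le> (\<Sum>u\<in>V. real (card {b \<in> W. \<not> E b u}))"
      using V(1) by (intro sum_mono2) (auto simp: bad_def)
    also have "\<dots> = (\<Sum>b\<in>W. real (card {u \<in> V. \<not> E b u}))"
      using sum.swap[of "\<lambda>u b. if \<not> E b u then 1 else 0 :: real" W V] W(1) V(1)
      by (simp add: sum.If_cases Int_def flip: of_nat_sum)
    also have "\<dots> \<le> (\<Sum>b\<in>W. (1 - \<epsilon>) * ?n / real (Suc r))"
      using deg W(2) by (intro sum_mono) (auto simp: field_simps simp del: of_nat_Suc)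
    also have "\<dots> = real (card W) * ((1 - \<epsilon>) * ?n / real (Suc r))"
      by simp
    also have "\<dots> \<le> real T * (1 - \<epsilon>) * ?n"
    proof (cases "V = {}")
      case False
      \<comment> \<open>The degree hypothesis at \<open>v\<close> gives
        \<open>(1 - \<epsilon>) * card V \<ge> 0\<close>, which does not follow from
        \<open>\<epsilon> > 0\<close> alone.\<close>
      then obtain v where "v \<in> V" by blast
      then have "0 \<le> (1 - \<epsilon>) * ?n" using deg
        by (meson mult_nonneg_nonneg of_nat_0_le_iff order_trans)
      then have "real (card W) * ((1 - \<epsilon>) * ?n / real (Suc r))
          \<le> real (Suc r * T) * ((1 - \<epsilon>) * ?n / real (Suc r))"
        using cW by (intro mult_right_mono divide_nonneg_nonneg of_nat_mono) auto
      also have "\<dots> = real T * (1 - \<epsilon>) * ?n" unfolding of_nat_mult by (simp del: of_nat_Suc)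
      finally show ?thesis .
    qed simp
    finally have sum: "(real T - real t) * real (card bad) \<le> real T * (1 - \<epsilon>) * ?n" .
    have "real T * (1 - \<epsilon> / 2) * real (card bad) \<le> (real T - real t) * real (card bad)"
      using T by (intro mult_right_mono) (auto simp: algebra_simps)
    with sum have "real T * ((1 - \<epsilon> / 2) * real (card bad)) \<le> real T * ((1 - \<epsilon>) * ?n)"
      by (simp add: algebra_simps)
    then have "(1 - \<epsilon> / 2) * real (card bad) \<le> (1 - \<epsilon>) * ?n"
      using T(2) by (simp only: mult_le_cancel_left_pos of_nat_0_less_iff)
    \<comment> \<open>Adding \<open>\<epsilon> / 2 * card bad \<le> \<epsilon> / 2 * card V\<close>
      avoids a division by \<open>1 - \<epsilon> / 2\<close>, whose sign is not known here.\<close>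
    moreover have cb: "real (card bad) \<le> ?n"
      using V(1) by (auto simp: bad_def intro!: card_mono)
    then have "\<epsilon> / 2 * real (card bad) \<le> \<epsilon> / 2 * ?n"
      using assms by (intro mult_left_mono) auto
    ultimately have "real (card bad) \<le> ?n - \<epsilon> / 2 * ?n"
      by (simp add: algebra_simps)
    moreover have "card (V - bad) = card V - card bad"
      using V(1) by (intro card_Diff_subset) (auto simp: bad_def)
    ultimately have good: "\<epsilon> / 2 * ?n \<le> real (card (V - bad))"
      using cb by linarith
    have "2 * real M / \<epsilon> < ?n" using V(2) unfolding n0_def by linarith
    then have "real M < \<epsilon> / 2 * ?n" using assms by (simp add: field_simps)
    with good have M: "M < card (V - bad)" by linarith
    have "card (Pow W) * t \<le> M"
      unfolding M_def using cW W(1) by (simp add: card_Pow)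
    with M have "card (Pow W) * t < card (V - bad)" by linarith
    then obtain Y where Y: "t \<le> card {u \<in> V - bad. {b \<in> W. E b u} = Y}"
      using pigeonhole_fibre[of "V - bad" "\<lambda>u. {b \<in> W. E b u}" "Pow W" t] V(1) W(1) by auto
    define F where "F = {u \<in> V - bad. {b \<in> W. E b u} = Y}"
    \<comment> \<open>The new part is \<open>F\<close>, and the old parts shrink to the common
      neighbourhood \<open>Y\<close>. A vertex of \<open>F\<close> is not bad, so each old part
      keeps at least \<open>t\<close> points; the case \<open>t = 0\<close> is split off because
      \<open>F\<close> may then be empty.\<close>
    define C where "C i = (if i = Suc r then F else B i \<inter> Y)" for i
    show "has_complete_multipartite E V (Suc (Suc r)) t"
    proof (cases "t = 0")
      case True
      then show ?thesis
        unfolding has_complete_multipartite_def by (intro exI[of _ "\<lambda>_. {}"]) auto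
    next
      case False
      moreover have "t \<le> card F" using Y unfolding F_def .
      ultimately have "F \<noteq> {}" by auto
      then obtain u where u: "u \<in> F" by blast
      have CB: "t \<le> card (B i \<inter> Y)" if "i \<le> r" for i
      proof -
        have "B i \<inter> Y = {b \<in> B i. E b u}"
          using u that unfolding F_def W_def by blast
        moreover have "u \<in> V" "u \<notin> bad" using u unfolding F_def by auto
        ultimately show ?thesis using that unfolding bad_def by force
      qed
      have BF: "E x y" "E y x" if "x \<in> Y" "y \<in> F" for x y
        using that sympD[OF V(3)] unfolding F_def by blast+
      show ?thesis
        unfolding has_complete_multipartite_def less_Suc_eq_le
      proof (intro exI[of _ C] conjI allI impI ballI)
        fix i assume i: "i \<le> Suc r"
        show "C i \<subseteq> V" using i B(1) B0(1) unfolding C_def F_def by (auto simp: le_Suc_eq)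
        show "t \<le> card (C i)" using i CB Y unfolding C_def F_def by (auto simp: le_Suc_eq)
      next
        fix i j x y
        assume "i \<le> Suc r" "j \<le> Suc r" "i \<noteq> j" "x \<in> C i" "y \<in> C j"
        then show "E x y"
          using BF B0(3)[of i j x y] B(1)[of i] B(1)[of j] unfolding C_def
          by (auto simp: le_Suc_eq subset_iff split: if_splits)
      qed
    qed
  qed
qed

subsection \<open>Strictly convex norms and strictly antipodal families\<close>

context
  fixes N :: "'a::real_vector \<Rightarrow> real"
  assumes N: "is_norm N"
begin

lemma is_norm_nonneg: "0 \<le> N x"
  and is_norm_eq_0_iff: "N x = 0 \<longleftrightarrow> x = 0"
  and is_norm_scaleR: "N (c *\<^sub>R x) = \<bar>c\<bar> * N x"
  and is_norm_triangle: "N (x + y) \<le> N x + N y"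
  using N unfolding is_norm_def by auto

lemma is_norm_pos: "x \<noteq> 0 \<Longrightarrow> 0 < N x"
  using is_norm_nonneg[of x] is_norm_eq_0_iff[of x] by linarith

lemma is_norm_minus_commute: "N (x - y) = N (y - x)"
  using is_norm_scaleR[of "-1" "x - y"] by simp

lemma is_norm_triangle_diff: "N (x - z) \<le> N (x - y) + N (y - z)"
  using is_norm_triangle[of "x - y" "y - z"] by simp

lemma convex_on_is_norm: "convex_on UNIV N"
proof (intro convex_onI)
  fix t :: real and x y
  assume "0 < t" "t < 1"
  then show "N ((1 - t) *\<^sub>R x + t *\<^sub>R y) \<le> (1 - t) * N x + t * N y"
    using is_norm_triangle[of "(1 - t) *\<^sub>R x" "t *\<^sub>R y"] by (simp add: is_norm_scaleR)
qed simp

end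

context
  fixes N :: "'a::euclidean_space \<Rightarrow> real"
  assumes N: "is_norm N"
begin

lemma continuous_on_is_norm: "continuous_on A N"
  using convex_on_continuous[OF open_UNIV convex_on_is_norm[OF N]]
  by (rule continuous_on_subset) simp

lemma open_is_norm_ball: "open {x. N x < r}"
  by (intro open_Collect_less continuous_on_is_norm continuous_on_const)

text \<open>By compactness \<open>N\<close> has a positive minimum on the Euclidean unit sphere, so
  by homogeneity it dominates a positive multiple of the Euclidean norm.\<close>

lemma bounded_is_norm_ball: "bounded {x. N x < r}"
proof -
  obtain u :: 'a where u: "u \<in> sphere 0 1" "\<And>x. x \<in> sphere 0 1 \<Longrightarrow> N u \<le> N x"
    using continuous_attains_inf[OF compact_sphere _ continuous_on_is_norm, of 0 1] by force
  have pos: "0 < N u" using u(1) by (intro is_norm_pos[OF N]) auto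
  have le: "norm x * N u \<le> N x" for x
  proof (cases "x = 0")
    case False
    then have "N u \<le> N (x /\<^sub>R norm x)" by (intro u(2)) simp
    also have "\<dots> = N x / norm x"
      by (simp add: is_norm_scaleR[OF N] divide_inverse mult.commute)
    finally show ?thesis using False by (simp add: field_simps)
  qed (simp add: is_norm_nonneg[OF N])
  show ?thesis
  proof (rule boundedI)
    fix x assume "x \<in> {x. N x < r}"
    with le[of x] have "norm x * N u \<le> r" by simp
    then show "norm x \<le> r / N u" using pos by (simp add: field_simps)
  qed
qed

lemma lmeasurable_is_norm_ball: "{x. N x < r} \<in> lmeasurable"
  by (rule lmeasurable_open[OF bounded_is_norm_ball open_is_norm_ball])

text \<open>Volume comparison: the balls of radius 1/4 about the points of \<open>S\<close> are
  disjoint and lie in the ball of radius 5/4 about \<open>c\<close>, whose volume is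
  \<open>5 ^ DIM('a)\<close> times as large. The bound does not depend on \<open>N\<close>.\<close>

lemma card_is_norm_separated_le:
  assumes "finite S" and near: "\<And>x. x \<in> S \<Longrightarrow> N (x - c) \<le> 1"
    and sep: "\<And>x y. x \<in> S \<Longrightarrow> y \<in> S \<Longrightarrow> x \<noteq> y \<Longrightarrow> 1 / 2 \<le> N (x - y)"
  shows "card S \<le> 5 ^ DIM('a)"
proof -
  let ?B = "{x. N x < 1 / 4}"
  let ?\<mu> = "measure lebesgue"
  have pos: "0 < ?\<mu> ?B"
  proof -
    have "?B \<noteq> {}" using is_norm_eq_0_iff[OF N, of 0] by (auto intro!: exI[of _ 0])
    then have "\<not> negligible ?B" using open_is_norm_ball open_not_negligible by blast
    then show ?thesis
      using lmeasurable_is_norm_ball[of "1/4"]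
      by (metis measure_nonneg less_eq_real_def negligible_iff_measure)
  qed
  have disj: "pairwise (\<lambda>x y. disjnt ((+) x ` ?B) ((+) y ` ?B)) S"
  proof (intro pairwiseI)
    fix x y assume xy: "x \<in> S" "y \<in> S" "x \<noteq> y"
    have False if "N a < 1 / 4" "N b < 1 / 4" "x + a = y + b" for a b
    proof -
      have "x - y = b - a" using that(3) by (simp add: algebra_simps)
      then have "N (x - y) \<le> N b + N a"
        using is_norm_triangle_diff[OF N, of b a 0] is_norm_minus_commute[OF N, of a 0] by simp
      with sep[OF xy] that show False by linarith
    qed
    then show "disjnt ((+) x ` ?B) ((+) y ` ?B)" unfolding disjnt_def by blast
  qed
  have sub: "(\<Union>x\<in>S. (+) x ` ?B) \<subseteq> (\<lambda>x. 5 *\<^sub>R x + c) ` ?B"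
  proof
    fix z assume "z \<in> (\<Union>x\<in>S. (+) x ` ?B)"
    then obtain x b where xb: "x \<in> S" "N b < 1 / 4" "z = x + b" by blast
    have "N (z - c) \<le> N b + N (x - c)"
      using is_norm_triangle[OF N, of b "x - c"] xb(3) by (simp add: algebra_simps)
    also have "\<dots> < 5 / 4" using near[OF xb(1)] xb(2) by linarith
    finally have "N ((1 / 5) *\<^sub>R (z - c)) < 1 / 4" by (simp add: is_norm_scaleR[OF N])
    then show "z \<in> (\<lambda>x. 5 *\<^sub>R x + c) ` ?B"
      by (intro image_eqI[of _ _ "(1 / 5) *\<^sub>R (z - c)"]) auto
  qed
  have "real (card S) * ?\<mu> ?B = (\<Sum>x\<in>S. ?\<mu> ((+) x ` ?B))"
    by (simp add: measure_translation)
  also have "\<dots> = ?\<mu> (\<Union>x\<in>S. (+) x ` ?B)"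
    by (intro measure_UNION'[symmetric] assms(1) disj measurable_translation
        lmeasurable_is_norm_ball)
  also have "\<dots> \<le> ?\<mu> ((\<lambda>x. 5 *\<^sub>R x + c) ` ?B)"
  proof (rule measure_mono_fmeasurable[OF sub])
    show "(\<Union>x\<in>S. (+) x ` ?B) \<in> sets lebesgue"
      by (intro sets.finite_UN assms(1) fmeasurableD measurable_translation lmeasurable_is_norm_ball)
    have "(\<lambda>x. 5 *\<^sub>R x + c) ` ?B = (+) c ` ((*\<^sub>R) 5 ` ?B)"
      by (auto simp: image_image add.commute)
    moreover have "(+) c ` ((*\<^sub>R) 5 ` ?B) \<in> lmeasurable"
      by (intro measurable_translation lmeasurable_open bounded_scaling open_scaling
          bounded_is_norm_ball open_is_norm_ball) simp
    ultimately show "(\<lambda>x. 5 *\<^sub>R x + c) ` ?B \<in> lmeasurable" by (simp only:)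
  qed
  also have "\<dots> = 5 ^ DIM('a) * ?\<mu> ?B"
    using measure_lebesgue_affine[of 5 c ?B] by (simp add: add.commute)
  finally have "real (card S) \<le> 5 ^ DIM('a)" using pos by simp
  then show ?thesis by (metis of_nat_le_iff of_nat_numeral of_nat_power)
qed

text \<open>A maximal \<open>1/2\<close>-separated subset has at most \<open>5 ^ DIM('a)\<close> points, and the balls of
  radius \<open>1/2\<close> around it cover the given set.\<close>

lemma large_subset_of_small_diameter:
  assumes "finite A" and near: "\<And>x. x \<in> A \<Longrightarrow> N (x - c) \<le> 1"
    and card: "5 ^ DIM('a) * m < card A"
  shows "\<exists>C\<subseteq>A. m \<le> card C \<and> (\<forall>x\<in>C. \<forall>y\<in>C. N (x - y) \<le> 1)"
proof -
  let ?sep = "\<lambda>M. M \<subseteq> A \<and> (\<forall>x\<in>M. \<forall>y\<in>M. x \<noteq> y \<longrightarrow> 1 / 2 \<le> N (x - y))"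
  have "?sep {}" by simp
  moreover have "\<forall>M. ?sep M \<longrightarrow> card M < Suc (card A)"
    using assms(1) by (simp add: card_mono less_Suc_eq_le)
  ultimately obtain M where M: "?sep M" "\<And>M'. ?sep M' \<Longrightarrow> card M' \<le> card M"
    using ex_has_greatest_nat[of ?sep "{}" card "Suc (card A)"] by blast
  have finM: "finite M" using M(1) assms(1) finite_subset by blast
  have cM: "card M \<le> 5 ^ DIM('a)"
    using M(1) finM near by (intro card_is_norm_separated_le[of _ c]) auto
  have "\<exists>y\<in>M. N (x - y) \<le> 1 / 2" if "x \<in> A" for x
  proof (rule ccontr)
    assume neg: "\<not> ?thesis"
    have "x \<notin> M"
    proof
      assume "x \<in> M"
      moreover have "N (x - x) \<le> 1 / 2" using is_norm_eq_0_iff[OF N, of 0] by simp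
      ultimately show False using neg by blast
    qed
    moreover have "?sep (insert x M)"
      using M(1) neg that is_norm_minus_commute[OF N, of x] by (auto simp: not_le less_imp_le)
    ultimately show False using M(2)[of "insert x M"] finM by simp
  qed
  then obtain f where f: "\<And>x. x \<in> A \<Longrightarrow> f x \<in> M" "\<And>x. x \<in> A \<Longrightarrow> N (x - f x) \<le> 1 / 2"
    by metis
  have "card M * m < card A"
    using mult_le_mono1[OF cM, of m] card by (rule le_less_trans)
  then obtain y where y: "m \<le> card {x \<in> A. f x = y}"
    using pigeonhole_fibre[OF assms(1) _ finM, of f m] f(1) by blast
  have "N (u - v) \<le> 1" if "u \<in> A" "v \<in> A" "f u = f v" for u v
    using is_norm_triangle_diff[OF N, of u v "f u"] is_norm_minus_commute[OF N, of "f u" v]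
      f(2)[OF that(1)] f(2)[OF that(2)] that(3) by simp
  then show ?thesis using y by (intro exI[of _ "{x \<in> A. f x = y}"]) auto
qed

end

section \<open>Supporting functionals of strictly convex norms\<close>

lemma strictly_convex_norm_imp_is_norm: "strictly_convex_norm N \<Longrightarrow> is_norm N"
  unfolding strictly_convex_norm_def by blast

text \<open>Separating \<open>v\<close> from the open unit ball gives, after scaling, a functional
  with \<open>\<phi> \<le> N\<close> and \<open>\<phi> v = 1\<close>. If another point
  \<open>x\<close> of the closed unit ball had \<open>\<phi> x \<ge> 1\<close>, the segment from
  \<open>x\<close> to \<open>v\<close> would lie in the unit sphere, against strict
  convexity.\<close>

lemma strictly_convex_norm_supporting_functional:
  fixes N :: "'a::euclidean_space \<Rightarrow> real"
  assumes "strictly_convex_norm N" and v: "N v = 1"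
  shows "\<exists>\<phi> :: 'a \<Rightarrow> real. linear \<phi> \<and> \<phi> v = 1 \<and> (\<forall>x. N x \<le> 1 \<longrightarrow> x \<noteq> v \<longrightarrow> \<phi> x < 1)"
proof -
  note N = strictly_convex_norm_imp_is_norm[OF assms(1)]
  let ?B = "{x. N x < 1}"
  have "convex ?B"
  proof (rule convexI)
    fix x y and s t :: real
    assume *: "x \<in> ?B" "y \<in> ?B" "0 \<le> s" "0 \<le> t" "s + t = 1"
    have "N (s *\<^sub>R x + t *\<^sub>R y) \<le> s * N x + t * N y"
      using is_norm_triangle[OF N, of "s *\<^sub>R x" "t *\<^sub>R y"] *(3,4) by (simp add: is_norm_scaleR[OF N])
    also have "\<dots> < 1" using * by (intro convex_bound_lt) auto
    finally show "s *\<^sub>R x + t *\<^sub>R y \<in> ?B" by simp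
  qed
  moreover have "0 \<in> ?B" using is_norm_eq_0_iff[OF N, of 0] by simp
  moreover have "?B \<inter> {v} = {}" using v by auto
  ultimately obtain a b where ab: "a \<noteq> 0" "\<And>x. N x < 1 \<Longrightarrow> a \<bullet> x \<le> b" "b \<le> a \<bullet> v"
    using separating_hyperplane_sets[of ?B "{v}"] by auto
  \<comment> \<open>Separation applies after scaling \<open>x\<close> to norm \<open>s < 1\<close>;
    the bound then follows as \<open>s\<close> tends to 1.\<close>
  have le: "a \<bullet> x \<le> N x * (a \<bullet> v)" for x
  proof (cases "x = 0")
    case False
    then have pos: "0 < N x" by (rule is_norm_pos[OF N])
    show ?thesis
    proof (rule field_le_mult_one_interval)
      fix s :: real assume s: "0 < s" "s < 1"
      have "N ((s / N x) *\<^sub>R x) < 1" using s pos by (simp add: is_norm_scaleR[OF N])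
      then have "s / N x * (a \<bullet> x) \<le> a \<bullet> v" using ab(2,3) by fastforce
      then show "s * (a \<bullet> x) \<le> N x * (a \<bullet> v)" using pos by (simp add: field_simps)
    qed
  qed (use is_norm_eq_0_iff[OF N, of 0] in simp)
  \<comment> \<open>The bound at \<open>x = a\<close> shows that \<open>a \<bullet> v\<close> is
    positive, so that \<open>\<phi>\<close> can be normalised by it.\<close>
  have "0 < a \<bullet> a" using ab(1) by simp
  also have "\<dots> \<le> N a * (a \<bullet> v)" by (rule le)
  finally have "0 < N a * (a \<bullet> v)" .
  then have pos: "0 < a \<bullet> v" using is_norm_nonneg[OF N, of a] by (auto simp: zero_less_mult_iff)
  define \<phi> where "\<phi> x = (a \<bullet> x) / (a \<bullet> v)" for x
  have "linear \<phi>" unfolding \<phi>_def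
    by (intro linearI) (auto simp: inner_add_right add_divide_distrib)
  moreover have "\<phi> v = 1" using pos by (simp add: \<phi>_def)
  moreover have "\<phi> x < 1" if x: "N x \<le> 1" "x \<noteq> v" for x
  proof (rule ccontr)
    assume *: "\<not> \<phi> x < 1"
    have "N z = 1" if "z \<in> closed_segment x v" for z
    proof -
      obtain u where u: "0 \<le> u" "u \<le> 1" "z = (1 - u) *\<^sub>R x + u *\<^sub>R v"
        using \<open>z \<in> _\<close> by (auto simp: in_segment)
      have "N z \<le> (1 - u) * N x + u * N v"
        using convex_onD[OF convex_on_is_norm[OF N], of u x v] u by simp
      also have "\<dots> \<le> 1" using u x(1) v by (intro convex_bound_le) auto
      finally have "N z \<le> 1" .
      moreover have "(1 - u) * 1 \<le> (1 - u) * \<phi> x" using * u by (intro mult_left_mono) auto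
      then have "1 \<le> \<phi> z"
        using u(3) \<open>\<phi> v = 1\<close> linear_add[OF \<open>linear \<phi>\<close>] linear_scale[OF \<open>linear \<phi>\<close>] by simp
      moreover have "\<phi> z \<le> N z" using le[of z] pos by (simp add: \<phi>_def field_simps)
      ultimately show ?thesis by linarith
    qed
    then show False using assms(1) x(2) unfolding strictly_convex_norm_def by blast
  qed
  ultimately show ?thesis by blast
qed

text \<open>Take \<open>\<phi>\<close> peaking only at \<open>q - p\<close> in the unit ball. For
  any third point \<open>r\<close>, both \<open>q - r\<close> and \<open>r - p\<close> lie in the
  ball and differ from \<open>q - p\<close>, so \<open>\<phi>\<close> is below 1 on each; this puts
  \<open>\<phi> r\<close> strictly between \<open>\<phi> p\<close> and
  \<open>\<phi> q\<close>.\<close>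

lemma strictly_antipodal_of_unit_distances:
  fixes N :: "'a::euclidean_space \<Rightarrow> real"
  assumes "strictly_convex_norm N"
    and unit: "\<And>i j p q. i \<in> I \<Longrightarrow> j \<in> I \<Longrightarrow> i \<noteq> j \<Longrightarrow> p \<in> A i \<Longrightarrow> q \<in> A j \<Longrightarrow> N (p - q) = 1"
    and small: "\<And>i p q. i \<in> I \<Longrightarrow> p \<in> A i \<Longrightarrow> q \<in> A i \<Longrightarrow> N (p - q) \<le> 1"
  shows "strictly_antipodal I A"
  unfolding strictly_antipodal_def
proof (intro ballI impI)
  fix i j p q assume ij: "i \<in> I" "j \<in> I" "i \<noteq> j" and pq: "p \<in> A i" "q \<in> A j"
  have le: "N (x - y) \<le> 1" if xy: "x \<in> (\<Union>k\<in>I. A k)" "y \<in> (\<Union>k\<in>I. A k)" for x y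
  proof -
    obtain k l where kl: "k \<in> I" "l \<in> I" "x \<in> A k" "y \<in> A l" using xy by blast
    show ?thesis
    proof (cases "k = l")
      case True
      then show ?thesis using small[OF kl(1,3)] kl(4) by simp
    next
      case False
      then show ?thesis using unit[OF kl(1,2) _ kl(3,4)] by simp
    qed
  qed
  have "N (q - p) = 1" using unit ij pq by blast
  then obtain \<phi> :: "'a \<Rightarrow> real" where \<phi>: "linear \<phi>" "\<phi> (q - p) = 1" "\<And>x. N x \<le> 1 \<Longrightarrow> x \<noteq> q - p \<Longrightarrow> \<phi> x < 1"
    using strictly_convex_norm_supporting_functional[OF assms(1), of "q - p"] by blast
  have "\<phi> p < \<phi> r \<and> \<phi> r < \<phi> q" if "r \<in> (\<Union>k\<in>I. A k) - {p, q}" for r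
  proof -
    have U: "p \<in> (\<Union>k\<in>I. A k)" "q \<in> (\<Union>k\<in>I. A k)" using ij pq by auto
    have "N (q - r) \<le> 1" "N (r - p) \<le> 1" using le that U by blast+
    moreover have "q - r \<noteq> q - p" "r - p \<noteq> q - p" using that by auto
    ultimately have "\<phi> (q - r) < 1" "\<phi> (r - p) < 1" using \<phi>(3) by blast+
    then show ?thesis using \<phi>(2) by (simp add: linear_diff[OF \<phi>(1)])
  qed
  then show "\<exists>\<phi> :: 'a \<Rightarrow> real. linear \<phi> \<and> (\<forall>r\<in>(\<Union>k\<in>I. A k) - {p, q}. \<phi> p < \<phi> r \<and> \<phi> r < \<phi> q)"
    using \<phi>(1) by blast
qed

text \<open>The differences \<open>d - a\<close> and \<open>b - c\<close> sum to twice the common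
  chord, so the functional peaking at \<open>b - a\<close> takes values with sum 2 on them. Neither
  value exceeds 1, hence both are 1, and uniqueness of the peak forces \<open>d = b\<close>.\<close>

lemma unit_chords_eq_of_diff_eq:
  fixes N :: "'a::euclidean_space \<Rightarrow> real"
  assumes "strictly_convex_norm N" and le: "\<forall>x\<in>S. \<forall>y\<in>S. N (x - y) \<le> 1"
    and S: "a \<in> S" "b \<in> S" "c \<in> S" "d \<in> S" and "N (b - a) = 1" "d - c = b - a"
  shows "c = a \<and> d = b"
proof -
  obtain \<phi> :: "'a \<Rightarrow> real" where \<phi>: "linear \<phi>" "\<phi> (b - a) = 1" "\<And>x. N x \<le> 1 \<Longrightarrow> x \<noteq> b - a \<Longrightarrow> \<phi> x < 1"
    using strictly_convex_norm_supporting_functional[OF assms(1,7)] by blast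
  have "\<phi> (d - a) + \<phi> (b - c) = \<phi> (d - c) + \<phi> (b - a)"
    by (simp add: linear_diff[OF \<phi>(1)])
  also have "\<dots> = 2" using \<phi>(2) assms(8) by simp
  finally have sum: "\<phi> (d - a) + \<phi> (b - c) = 2" .
  show ?thesis
  proof (rule ccontr)
    assume "\<not> ?thesis"
    then have "d - a \<noteq> b - a" using assms(8) by auto
    then have "\<phi> (d - a) < 1" using le S by (intro \<phi>(3)) auto
    moreover have "\<phi> (b - c) \<le> 1"
      using \<phi>(2) \<phi>(3)[of "b - c"] le S by (cases "b - c = b - a") auto
    ultimately show False using sum by linarith
  qed
qed

text \<open>Parallel segments of unit length have differences equal up to sign. After orienting them
  alike, \<open>unit_chords_eq_of_diff_eq\<close> identifies their endpoints.\<close>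

lemma pairwise_nonparallel_unit_pairs:
  fixes N :: "'a::euclidean_space \<Rightarrow> real"
  assumes "strictly_convex_norm N" and le: "\<forall>x\<in>S. \<forall>y\<in>S. N (x - y) \<le> 1"
  shows "pairwise (\<lambda>e f. \<not> parallel e f) (unit_pairs N S)"
proof (rule pairwiseI, rule notI)
  fix e f assume ef: "e \<in> unit_pairs N S" "f \<in> unit_pairs N S" "e \<noteq> f" "parallel e f"
  note N = strictly_convex_norm_imp_is_norm[OF assms(1)]
  from ef(4) obtain a b c d t where abcd: "e = {a, b}" "f = {c, d}" "d - c = t *\<^sub>R (b - a)"
    unfolding parallel_def by blast
  have unit: "x \<in> S \<and> y \<in> S \<and> N (y - x) = 1" if "{x, y} \<in> unit_pairs N S" for x y
    using that is_norm_minus_commute[OF N, of x y] unfolding unit_pairs_def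
    by (auto simp: doubleton_eq_iff)
  have e: "a \<in> S" "b \<in> S" "N (b - a) = 1" and f: "c \<in> S" "d \<in> S" "N (d - c) = 1"
    using unit ef(1,2) abcd(1,2) by auto
  then have "\<bar>t\<bar> = 1" using abcd(3) by (simp add: is_norm_scaleR[OF N])
  then consider "t = 1" | "t = -1" by linarith
  then have "{c, d} = {a, b}"
  proof cases
    case 1
    then have "c = a \<and> d = b"
      using unit_chords_eq_of_diff_eq[OF assms, of a b c d] e f abcd(3) by simp
    then show ?thesis by simp
  next
    case 2
    then have "c - d = b - a" using abcd(3) by (simp add: algebra_simps)
    then have "d = a \<and> c = b"
      using unit_chords_eq_of_diff_eq[OF assms, of a b d c] e f by simp
    then show ?thesis by auto
  qed
  then show False using ef(3) abcd by simp
qed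

section \<open>Rescaling and diameters\<close>

lemma strictly_convex_norm_rescale:
  assumes "strictly_convex_norm N" "0 < D"
  shows "strictly_convex_norm (\<lambda>x. N x / D)"
proof -
  note N = strictly_convex_norm_imp_is_norm[OF assms(1)]
  have "is_norm (\<lambda>x. N x / D)"
    unfolding is_norm_def using assms(2)
    by (auto simp: is_norm_nonneg[OF N] is_norm_eq_0_iff[OF N] is_norm_scaleR[OF N]
        is_norm_triangle[OF N] divide_right_mono simp flip: add_divide_distrib)
  moreover have False if xy: "x \<noteq> y" "closed_segment x y \<subseteq> {z. N z / D = 1}" for x y
  proof -
    have "N z = 1" if z: "z \<in> closed_segment (x /\<^sub>R D) (y /\<^sub>R D)" for z
    proof -
      obtain u where u: "0 \<le> u" "u \<le> 1" "z = (1 - u) *\<^sub>R (x /\<^sub>R D) + u *\<^sub>R (y /\<^sub>R D)"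
        using z by (auto simp: in_segment)
      have "z = ((1 - u) *\<^sub>R x + u *\<^sub>R y) /\<^sub>R D" unfolding u(3) by (simp add: algebra_simps)
      moreover have "N ((1 - u) *\<^sub>R x + u *\<^sub>R y) = D"
        using xy(2) u(1,2) assms(2) by (auto simp: closed_segment_def)
      ultimately show ?thesis using assms(2) by (simp add: is_norm_scaleR[OF N])
    qed
    moreover have "x /\<^sub>R D \<noteq> y /\<^sub>R D" using xy(1) assms(2) by simp
    ultimately show False using assms(1) unfolding strictly_convex_norm_def by blast
  qed
  ultimately show ?thesis unfolding strictly_convex_norm_def by blast
qed

lemma norm_diameter_upper:
  assumes "finite S" "x \<in> S" "y \<in> S"
  shows "N (x - y) \<le> norm_diameter N S"
proof -
  have "N (x - y) \<le> (SUP (x, y) \<in> S \<times> S. N (x - y))"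
    using assms by (intro cSUP_upper2[of _ _ "(x, y)"]) (auto intro: bdd_above_finite)
  then show ?thesis using assms(2) unfolding norm_diameter_def by auto
qed

lemma norm_diameter_eq:
  assumes "finite S" "x \<in> S" "y \<in> S" "\<And>u v. u \<in> S \<Longrightarrow> v \<in> S \<Longrightarrow> N (u - v) \<le> N (x - y)"
  shows "norm_diameter N S = N (x - y)"
proof (rule antisym)
  have "(SUP (x, y) \<in> S \<times> S. N (x - y)) \<le> N (x - y)"
    using assms by (intro cSUP_least) auto
  then show "norm_diameter N S \<le> N (x - y)" using assms(2) unfolding norm_diameter_def by auto
qed (intro norm_diameter_upper assms)

lemma diameter_pairs_eq_unit_pairs:
  assumes "0 < norm_diameter N S"
  shows "diameter_pairs N S = unit_pairs (\<lambda>x. N x / norm_diameter N S) S"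
proof -
  have "N x / norm_diameter N S = 1 \<longleftrightarrow> N x = norm_diameter N S" for x
    using assms by auto
  then show ?thesis unfolding diameter_pairs_def unit_pairs_def by simp
qed

section \<open>Strictly convex norms with prescribed unit chords\<close>

lemma strictly_convex_norm_Max:
  fixes L :: "'i \<Rightarrow> 'a::real_vector \<Rightarrow> 'b::euclidean_space"
  assumes I: "finite I" "I \<noteq> {}" and lin: "\<And>i. i \<in> I \<Longrightarrow> linear (L i)"
    and inj: "\<And>i. i \<in> I \<Longrightarrow> inj (L i)"
  shows "strictly_convex_norm (\<lambda>x. Max ((\<lambda>i. norm (L i x)) ` I))"
proof -
  define N where "N x = Max ((\<lambda>i. norm (L i x)) ` I)" for x
  have ge: "norm (L i x) \<le> N x" if "i \<in> I" for i x
    unfolding N_def using I that by (intro Max_ge) auto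
  have attained: "\<exists>i\<in>I. N x = norm (L i x)" for x
    unfolding N_def using Max_in[of "(\<lambda>i. norm (L i x)) ` I"] I by blast
  have "is_norm N"
    unfolding is_norm_def
  proof (intro conjI allI)
    fix x y c
    show "0 \<le> N x" using attained[of x] by auto
    show "N x = 0 \<longleftrightarrow> x = 0"
    proof
      assume "N x = 0"
      obtain i where "i \<in> I" using I by blast
      with ge[of i x] \<open>N x = 0\<close> have "L i x = L i 0"
        using linear_0[OF lin] by simp
      then show "x = 0" using inj[OF \<open>i \<in> I\<close>] by (auto dest: injD)
    next
      assume "x = 0"
      then show "N x = 0" using attained[of x] linear_0[OF lin] by auto
    qed
    show "N (c *\<^sub>R x) = \<bar>c\<bar> * N x"
    proof (rule antisym)
      obtain i where "i \<in> I" "N (c *\<^sub>R x) = norm (L i (c *\<^sub>R x))" using attained by blast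
      then show "N (c *\<^sub>R x) \<le> \<bar>c\<bar> * N x"
        using ge[of i x] by (simp add: linear_scale[OF lin] mult_left_mono)
      obtain j where "j \<in> I" "N x = norm (L j x)" using attained by blast
      then show "\<bar>c\<bar> * N x \<le> N (c *\<^sub>R x)"
        using ge[of j "c *\<^sub>R x"] by (simp add: linear_scale[OF lin])
    qed
    obtain i where i: "i \<in> I" "N (x + y) = norm (L i (x + y))" using attained by blast
    then show "N (x + y) \<le> N x + N y"
      using ge[of i x] ge[of i y] norm_triangle_ineq[of "L i x" "L i y"]
      by (simp add: linear_add[OF lin])
  qed
  \<comment> \<open>On a segment in the unit sphere, take an index \<open>i\<close> attaining the
    maximum at the midpoint. Euclidean strict convexity makes \<open>norm (L i _)\<close> exceed 1
    at one of the endpoints, because injectivity keeps their images distinct.\<close>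
  moreover have False if xy: "x \<noteq> y" "closed_segment x y \<subseteq> {z. N z = 1}" for x y
  proof -
    have mid: "N (midpoint x y) = 1" "N x = 1" "N y = 1"
      using subsetD[OF xy(2), of "midpoint x y"] subsetD[OF xy(2), of x] subsetD[OF xy(2), of y]
      by auto
    obtain i where i: "i \<in> I" "norm (L i (midpoint x y)) = 1" using attained mid(1) by metis
    have "L i x \<noteq> L i y" using xy(1) inj[OF i(1)] by (auto dest: injD)
    moreover have "L i (midpoint x y) = midpoint (L i x) (L i y)"
      by (simp add: midpoint_def linear_scale[OF lin[OF i(1)]] linear_add[OF lin[OF i(1)]])
    ultimately have "norm (L i (midpoint x y)) < norm (L i x) \<or> norm (L i (midpoint x y)) < norm (L i y)"
      using dist_decreases_open_segment[of "L i (midpoint x y)" "L i x" "L i y" 0] by simp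
    then show False using ge[OF i(1), of x] ge[OF i(1), of y] mid i(2) by linarith
  qed
  ultimately show ?thesis unfolding strictly_convex_norm_def N_def by blast
qed

text \<open>This norm shows that the sets under \<open>Max\<close> in the three extremal functions
  are nonempty.\<close>

lemma strictly_convex_norm_norm: "strictly_convex_norm (norm :: 'a::euclidean_space \<Rightarrow> real)"
  using strictly_convex_norm_Max[of "{()}" "\<lambda>_ x :: 'a. x"] by (simp add: linear_ident)

text \<open>Each chord \<open>v = q - p\<close> contributes the ellipsoid
  \<open>{x. (\<phi> x)\<^sup>2 + \<epsilon>\<^sup>2 * (norm (x - \<phi> x *\<^sub>R v))\<^sup>2 \<le> 1}\<close>, which touches the slab \<open>\<bar>\<phi> x\<bar> \<le> 1\<close>
  at \<open>\<plusminus>v\<close>; the unit ball is the intersection of these ellipsoids for small \<open>\<epsilon>\<close>.\<close>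

lemma strictly_convex_norm_of_exposed_chords:
  fixes U :: "'a::euclidean_space set"
  assumes "finite U" and P: "P \<subseteq> U \<times> U" "P \<noteq> {}"
    and exposed: "\<And>p q. (p, q) \<in> P \<Longrightarrow> \<exists>\<phi> :: 'a \<Rightarrow> real. linear \<phi> \<and> \<phi> (q - p) = 1 \<and>
      (\<forall>r\<in>U. \<forall>s\<in>U. (r, s) \<noteq> (p, q) \<longrightarrow> (r, s) \<noteq> (q, p) \<longrightarrow> \<bar>\<phi> (s - r)\<bar> < 1)"
  shows "\<exists>N. strictly_convex_norm N \<and> (\<forall>(p, q)\<in>P. N (q - p) = 1) \<and>
    (\<forall>r\<in>U. \<forall>s\<in>U. N (s - r) \<le> 1)"
proof -
  have "\<forall>v\<in>P. \<exists>\<phi> :: 'a \<Rightarrow> real. linear \<phi> \<and> \<phi> (snd v - fst v) = 1 \<and>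
      (\<forall>r\<in>U. \<forall>s\<in>U. (r, s) \<noteq> v \<longrightarrow> (s, r) \<noteq> v \<longrightarrow> \<bar>\<phi> (s - r)\<bar> < 1)"
    using exposed by force
  then obtain \<phi> :: "'a \<times> 'a \<Rightarrow> 'a \<Rightarrow> real" where \<phi>: "\<And>v. v \<in> P \<Longrightarrow> linear (\<phi> v)"
    "\<And>v. v \<in> P \<Longrightarrow> \<phi> v (snd v - fst v) = 1"
    "\<And>v r s. v \<in> P \<Longrightarrow> r \<in> U \<Longrightarrow> s \<in> U \<Longrightarrow> (r, s) \<noteq> v \<Longrightarrow> (s, r) \<noteq> v \<Longrightarrow> \<bar>\<phi> v (s - r)\<bar> < 1"
    by metis
  \<comment> \<open>With the Euclidean norm on the product,
    \<open>norm (L \<epsilon> v x) \<le> 1\<close> describes the ellipsoid of \<open>v\<close>. On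
    the chord and its reverse the second component vanishes, so their norm is 1 for every
    \<open>\<epsilon>\<close>; for all other pairs the norm tends to
    \<open>\<bar>\<phi> v (s - r)\<bar> < 1\<close> as \<open>\<epsilon>\<close> tends to 0.
    Positive \<open>\<epsilon>\<close> makes \<open>L \<epsilon> v\<close> injective.\<close>
  define L where "L \<epsilon> v x = (\<phi> v x, \<epsilon> *\<^sub>R (x - \<phi> v x *\<^sub>R (snd v - fst v)))" for \<epsilon> :: real and v x
  have finP: "finite P" using assms(1) P(1) finite_subset by blast
  have chord: "norm (L \<epsilon> v (snd v - fst v)) = 1" "norm (L \<epsilon> v (fst v - snd v)) = 1" if "v \<in> P" for \<epsilon> v
    using \<phi>(1,2)[OF that] linear_neg[OF \<phi>(1)[OF that], of "snd v - fst v"]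
    unfolding L_def by (simp_all add: norm_Pair)
  have ev: "\<forall>\<^sub>F \<epsilon> in at_right 0. norm (L \<epsilon> v (s - r)) \<le> 1" if "v \<in> P" "r \<in> U" "s \<in> U" for v r s
  proof (cases "(r, s) = v \<or> (s, r) = v")
    case True
    then show ?thesis using chord[OF that(1)] by force
  next
    case False
    let ?u = "s - r - \<phi> v (s - r) *\<^sub>R (snd v - fst v)"
    have "((\<lambda>\<epsilon>. norm (\<phi> v (s - r), \<epsilon> *\<^sub>R ?u)) \<longlongrightarrow> norm (\<phi> v (s - r), 0 *\<^sub>R ?u)) (at_right 0)"
      by (intro tendsto_intros)
    moreover have "norm (\<phi> v (s - r), 0 *\<^sub>R ?u) < 1"
      using \<phi>(3)[OF that] False by (simp add: norm_Pair)
    ultimately have "\<forall>\<^sub>F \<epsilon> in at_right 0. norm (\<phi> v (s - r), \<epsilon> *\<^sub>R ?u) < 1"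
      by (rule order_tendstoD(2))
    then show ?thesis unfolding L_def by (rule eventually_mono) simp
  qed
  have "\<forall>\<^sub>F \<epsilon> in at_right 0. \<forall>v\<in>P. \<forall>r\<in>U. \<forall>s\<in>U. norm (L \<epsilon> v (s - r)) \<le> 1"
    using ev by (intro eventually_ball_finite finP assms(1) ballI)
  moreover have "\<forall>\<^sub>F \<epsilon> in at_right 0. (0 :: real) < \<epsilon>"
    by (rule eventually_at_right_less)
  ultimately have "\<forall>\<^sub>F \<epsilon> in at_right 0. 0 < \<epsilon> \<and> (\<forall>v\<in>P. \<forall>r\<in>U. \<forall>s\<in>U. norm (L \<epsilon> v (s - r)) \<le> 1)"
    by eventually_elim simp
  then obtain \<epsilon> where \<epsilon>: "0 < \<epsilon>" "\<And>v r s. v \<in> P \<Longrightarrow> r \<in> U \<Longrightarrow> s \<in> U \<Longrightarrow> norm (L \<epsilon> v (s - r)) \<le> 1"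
    using eventually_happens'[OF trivial_limit_at_right_real] by blast
  define N where "N x = Max ((\<lambda>v. norm (L \<epsilon> v x)) ` P)" for x
  have "strictly_convex_norm N"
    unfolding N_def
  proof (rule strictly_convex_norm_Max[OF finP P(2)])
    fix v assume v: "v \<in> P"
    show lin: "linear (L \<epsilon> v)"
      unfolding L_def
      by (intro linearI) (simp_all add: linear_add[OF \<phi>(1)[OF v]] linear_scale[OF \<phi>(1)[OF v]] algebra_simps)
    show "inj (L \<epsilon> v)"
      unfolding linear_injective_0[OF lin] using \<epsilon>(1) by (auto simp: L_def zero_prod_def)
  qed
  moreover have le: "N (s - r) \<le> 1" if "r \<in> U" "s \<in> U" for r s
    unfolding N_def using finP P(2) \<epsilon>(2) that by (intro Max.boundedI) auto
  moreover have "N (q - p) = 1" if "(p, q) \<in> P" for p q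
  proof (rule antisym)
    show "N (q - p) \<le> 1" using le that P(1) by blast
    have "norm (L \<epsilon> (p, q) (q - p)) \<le> N (q - p)"
      unfolding N_def using finP that by (intro Max_ge) auto
    then show "1 \<le> N (q - p)" using chord(1)[OF that, of \<epsilon>] by simp
  qed
  ultimately show ?thesis by blast
qed

text \<open>A converse to \<open>strictly_antipodal_of_unit_distances\<close>. The antipodality
  functional of \<open>p\<close> and \<open>q\<close> maps \<open>U\<close> into the interval from
  \<open>\<phi> p\<close> to \<open>\<phi> q\<close> and reaches the ends only at \<open>p\<close>
  and \<open>q\<close>. Normalised to 1 on \<open>q - p\<close>, it therefore exposes this chord
  among all differences.\<close>

lemma strictly_convex_norm_of_strictly_antipodal:
  fixes A :: "'i \<Rightarrow> 'a::euclidean_space set" and I :: "'i set"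
  defines "U \<equiv> \<Union>i\<in>I. A i"
  assumes antipodal: "strictly_antipodal I A" and U: "finite U" "3 \<le> card U"
    and nonempty: "i0 \<in> I" "j0 \<in> I" "i0 \<noteq> j0" "A i0 \<noteq> {}" "A j0 \<noteq> {}"
  shows "\<exists>N. strictly_convex_norm N \<and>
    (\<forall>i\<in>I. \<forall>j\<in>I. i \<noteq> j \<longrightarrow> (\<forall>p\<in>A i. \<forall>q\<in>A j. N (p - q) = 1)) \<and> (\<forall>r\<in>U. \<forall>s\<in>U. N (r - s) \<le> 1)"
proof -
  define P where "P = {(p, q). \<exists>i\<in>I. \<exists>j\<in>I. i \<noteq> j \<and> p \<in> A i \<and> q \<in> A j}"
  have "P \<subseteq> U \<times> U" unfolding P_def U_def by auto
  moreover have "P \<noteq> {}" using nonempty unfolding P_def by auto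
  moreover have "\<exists>\<psi> :: 'a \<Rightarrow> real. linear \<psi> \<and> \<psi> (q - p) = 1 \<and>
      (\<forall>r\<in>U. \<forall>s\<in>U. (r, s) \<noteq> (p, q) \<longrightarrow> (r, s) \<noteq> (q, p) \<longrightarrow> \<bar>\<psi> (s - r)\<bar> < 1)"
    if pq: "(p, q) \<in> P" for p q
  proof -
    obtain i j where ij: "i \<in> I" "j \<in> I" "i \<noteq> j" "p \<in> A i" "q \<in> A j"
      using pq unfolding P_def by blast
    have "\<exists>\<phi> :: 'a \<Rightarrow> real. linear \<phi> \<and> (\<forall>r\<in>U - {p, q}. \<phi> p < \<phi> r \<and> \<phi> r < \<phi> q)"
      using antipodal ij unfolding strictly_antipodal_def U_def by simp
    then obtain \<phi> :: "'a \<Rightarrow> real" where \<phi>: "linear \<phi>"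
      "\<And>r. r \<in> U - {p, q} \<Longrightarrow> \<phi> p < \<phi> r \<and> \<phi> r < \<phi> q"
      by blast
    \<comment> \<open>A third point is what yields \<open>\<phi> p < \<phi> q\<close>: if
      \<open>U\<close> were just \<open>{p, q}\<close>, the antipodality condition would be vacuous
      and \<open>\<phi>\<close> could be zero.\<close>
    have "card {p, q} < card U" using U(2) card_insert_le_m1[of 2 "{q}" p] by simp
    then have "\<not> U \<subseteq> {p, q}" using card_mono[of "{p, q}" U] by auto
    then obtain r0 where "r0 \<in> U - {p, q}" by blast
    then have less: "\<phi> p < \<phi> q" using \<phi>(2)[of r0] by linarith
    define \<psi> where "\<psi> x = \<phi> x / (\<phi> q - \<phi> p)" for x
    have "linear \<psi>"
      unfolding \<psi>_def
      by (intro linearI) (simp_all add: linear_add[OF \<phi>(1)] linear_scale[OF \<phi>(1)] add_divide_distrib)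
    moreover have "\<psi> (q - p) = 1"
      unfolding \<psi>_def using less by (simp add: linear_diff[OF \<phi>(1)])
    moreover have "\<bar>\<psi> (s - r)\<bar> < 1"
      if rs: "r \<in> U" "s \<in> U" "(r, s) \<noteq> (p, q)" "(r, s) \<noteq> (q, p)" for r s
    proof -
      have *: "x = p \<or> x = q \<or> \<phi> p < \<phi> x \<and> \<phi> x < \<phi> q" if "x \<in> U" for x
        using \<phi>(2)[of x] that by blast
      have "\<bar>\<phi> s - \<phi> r\<bar> < \<phi> q - \<phi> p"
        using *[OF rs(1)] *[OF rs(2)] rs(3,4) less by auto
      then show ?thesis unfolding \<psi>_def using less by (simp add: linear_diff[OF \<phi>(1)] abs_divide)
    qed
    ultimately show ?thesis by blast
  qed
  ultimately obtain N where N: "strictly_convex_norm N" "\<forall>(p, q)\<in>P. N (q - p) = 1"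
    "\<forall>r\<in>U. \<forall>s\<in>U. N (s - r) \<le> 1"
    using strictly_convex_norm_of_exposed_chords[OF U(1), of P] by blast
  moreover have "N (p - q) = 1" if "i \<in> I" "j \<in> I" "i \<noteq> j" "p \<in> A i" "q \<in> A j" for i j p q
  proof -
    have "(q, p) \<in> P" unfolding P_def mem_Collect_eq prod.case
      by (rule bexI[of _ j], rule bexI[of _ i]) (use that in auto)
    with N(2) show ?thesis by auto
  qed
  ultimately show ?thesis by blast
qed

lemma strictly_antipodal_mono:
  fixes A B :: "'i \<Rightarrow> 'a::real_vector set"
  assumes "strictly_antipodal I A" "\<And>i. i \<in> I \<Longrightarrow> B i \<subseteq> A i"
  shows "strictly_antipodal I B"
  unfolding strictly_antipodal_def
proof (intro ballI impI)
  fix i j p q assume ij: "i \<in> I" "j \<in> I" "i \<noteq> j" "p \<in> B i" "q \<in> B j"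
  then have "p \<in> A i" "q \<in> A j" using assms(2) by blast+
  then have "\<exists>\<phi> :: 'a \<Rightarrow> real. linear \<phi> \<and> (\<forall>r\<in>(\<Union>k\<in>I. A k) - {p, q}. \<phi> p < \<phi> r \<and> \<phi> r < \<phi> q)"
    using assms(1) ij(1-3) unfolding strictly_antipodal_def by simp
  moreover have "(\<Union>k\<in>I. B k) - {p, q} \<subseteq> (\<Union>k\<in>I. A k) - {p, q}"
    using assms(2) by blast
  ultimately show "\<exists>\<phi> :: 'a \<Rightarrow> real. linear \<phi> \<and>
      (\<forall>r\<in>(\<Union>k\<in>I. B k) - {p, q}. \<phi> p < \<phi> r \<and> \<phi> r < \<phi> q)"
    by (meson subsetD)
qed

subsection \<open>Asymptotics\<close>

lemma finite_subset_of_size: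
  assumes "infinite A \<or> m \<le> card A"
  shows "\<exists>B\<subseteq>A. finite B \<and> card B = m"
  using assms by (metis infinite_arbitrarily_large obtain_subset_with_card_n)

text \<open>One point from each member gives \<open>k\<close> points at mutual distance 1 in a
  suitable norm, and packing bounds their number. Size 3 supplies the third point required by the
  construction of that norm.\<close>

lemma antipodal_families_bounded:
  fixes A :: "nat \<Rightarrow> 'a::euclidean_space set"
  assumes "strictly_antipodal {..<k} A" "\<And>i. i < k \<Longrightarrow> infinite (A i) \<or> 3 \<le> card (A i)"
  shows "k \<le> 5 ^ DIM('a)"
proof (cases "k \<le> 1")
  case True
  then show ?thesis by (metis le_trans one_le_numeral one_le_power)
next
  case False
  have "\<exists>B\<subseteq>A i. finite B \<and> card B = 3" if "i < k" for i
    using assms(2)[OF that] by (rule finite_subset_of_size)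
  then obtain B where B: "\<And>i. i < k \<Longrightarrow> B i \<subseteq> A i \<and> finite (B i) \<and> card (B i) = 3"
    by metis
  have anti: "strictly_antipodal {..<k} B"
    using assms(1) by (rule strictly_antipodal_mono) (use B in auto)
  let ?U = "\<Union>i<k. B i"
  have "finite ?U" using B by auto
  moreover have "3 \<le> card ?U"
    using card_mono[OF \<open>finite ?U\<close>, of "B 0"] B[of 0] False by force
  moreover have ne: "B i \<noteq> {}" if "i < k" for i using B[OF that] by auto
  ultimately obtain N where N: "strictly_convex_norm N"
    "\<forall>i\<in>{..<k}. \<forall>j\<in>{..<k}. i \<noteq> j \<longrightarrow> (\<forall>p\<in>B i. \<forall>q\<in>B j. N (p - q) = 1)"
    using strictly_convex_norm_of_strictly_antipodal[OF anti, of 0 1] False by auto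
  note norm = strictly_convex_norm_imp_is_norm[OF N(1)]
  define x where "x i = (SOME y. y \<in> B i)" for i
  have x: "x i \<in> B i" if "i < k" for i
    using ne[OF that] by (simp add: x_def some_in_eq)
  have dist: "N (x i - x j) = 1" if "i < k" "j < k" "i \<noteq> j" for i j
    using N(2) x that by blast
  have zero: "N 0 = 0" using is_norm_eq_0_iff[OF norm] by simp
  have "inj_on x {..<k}"
  proof (rule inj_onI, rule ccontr)
    fix i j assume "i \<in> {..<k}" "j \<in> {..<k}" "x i = x j" "i \<noteq> j"
    then show False using dist[of i j] zero by simp
  qed
  then have "k = card (x ` {..<k})" by (simp add: card_image)
  also have "\<dots> \<le> 5 ^ DIM('a)"
  proof (rule card_is_norm_separated_le[OF norm])
    show "N (y - x 0) \<le> 1" if y: "y \<in> x ` {..<k}" for y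
    proof -
      obtain i where "i < k" "y = x i" using y by auto
      then show ?thesis using dist[of i 0] zero False by (cases "i = 0") auto
    qed
    show "1 / 2 \<le> N (y - z)" if yz: "y \<in> x ` {..<k}" "z \<in> x ` {..<k}" "y \<noteq> z" for y z
    proof -
      obtain i j where "i < k" "j < k" "i \<noteq> j" "y = x i" "z = x j" using yz by auto
      then show ?thesis using dist by simp
    qed
  qed simp
  finally show ?thesis .
qed

text \<open>This is the property under \<open>GREATEST\<close> in
  \<open>antipodal_number\<close>.\<close>

definition has_large_antipodal_families :: "'d::finite itself \<Rightarrow> nat \<Rightarrow> bool" where
  "has_large_antipodal_families _ k \<longleftrightarrow> (\<forall>m>0. \<exists>A :: nat \<Rightarrow> (real ^ 'd) set.
     strictly_antipodal {..<k} A \<and> (\<forall>i<k. infinite (A i) \<or> m \<le> card (A i)))"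

lemma has_large_antipodal_familiesD:
  fixes T :: "'d::finite itself"
  assumes "has_large_antipodal_families T k" "0 < m"
  shows "\<exists>A :: nat \<Rightarrow> (real ^ 'd) set.
    strictly_antipodal {..<k} A \<and> (\<forall>i<k. infinite (A i) \<or> m \<le> card (A i))"
  using assms unfolding has_large_antipodal_families_def by simp

text \<open>The greatest value is attained because the property holds for \<open>k = 1\<close>,
  where antipodality is vacuous, and fails for all \<open>k\<close> above the packing bound.\<close>

lemma antipodal_number_greatest:
  fixes T :: "'d::finite itself"
  shows "has_large_antipodal_families T (antipodal_number T)"
    and "has_large_antipodal_families T k \<Longrightarrow> k \<le> antipodal_number T"
    and "1 \<le> antipodal_number T"
proof -
  have eq: "antipodal_number T = (GREATEST k. has_large_antipodal_families T k)"
    unfolding antipodal_number_def has_large_antipodal_families_def ..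
  have one: "has_large_antipodal_families T 1"
    unfolding has_large_antipodal_families_def
  proof (intro allI impI exI conjI)
    show "strictly_antipodal {..<1 :: nat} (\<lambda>_. UNIV :: (real ^ 'd) set)"
      unfolding strictly_antipodal_def by auto
    show "infinite (UNIV :: (real ^ 'd) set) \<or> m \<le> card (UNIV :: (real ^ 'd) set)" for m
      by (simp add: infinite_UNIV_char_0)
  qed
  have bound: "k \<le> 5 ^ DIM(real ^ 'd)" if k: "has_large_antipodal_families T k" for k
  proof -
    obtain A :: "nat \<Rightarrow> (real ^ 'd) set" where
      "strictly_antipodal {..<k} A" "\<forall>i<k. infinite (A i) \<or> 3 \<le> card (A i)"
      using has_large_antipodal_familiesD[OF k, of 3] by auto
    then show ?thesis by (intro antipodal_families_bounded) auto
  qed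
  show "has_large_antipodal_families T (antipodal_number T)"
    unfolding eq by (rule GreatestI_nat[where P = "has_large_antipodal_families T", OF one]) (rule bound)
  show le: "has_large_antipodal_families T k \<Longrightarrow> k \<le> antipodal_number T" for k
    unfolding eq by (rule Greatest_le_nat) (use bound in auto)
  show "1 \<le> antipodal_number T" by (rule le[OF one])
qed

section \<open>Comparison of the three maxima\<close>

lemma unit_pairs_eq_edge_pairs: "unit_pairs N S = edge_pairs (\<lambda>x y. N (x - y) = 1) S"
  unfolding unit_pairs_def edge_pairs_def ..

lemma diameter_pairs_eq_edge_pairs:
  "diameter_pairs N S = edge_pairs (\<lambda>x y. N (x - y) = norm_diameter N S) S"
  unfolding diameter_pairs_def edge_pairs_def ..

lemma max_unit_pairs_upper:
  fixes N :: "real ^ 'd::finite \<Rightarrow> real"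
  assumes "strictly_convex_norm N" "finite S"
  shows "card (unit_pairs N S) \<le> max_unit_pairs TYPE('d) (card S)"
  unfolding max_unit_pairs_def
proof (rule Max_ge)
  show "finite {card (unit_pairs N S') | (N :: real ^ 'd \<Rightarrow> real) S'.
      strictly_convex_norm N \<and> finite S' \<and> card S' = card S}"
    by (rule finite_subset[of _ "{..card S choose 2}"])
       (auto simp: unit_pairs_eq_edge_pairs intro: card_edge_pairs_le_choose[THEN order_trans])
qed (use assms in blast)

lemma max_nonparallel_unit_segments_upper:
  fixes N :: "real ^ 'd::finite \<Rightarrow> real"
  assumes "strictly_convex_norm N" "finite S" "E \<subseteq> unit_pairs N S"
    "pairwise (\<lambda>e f. \<not> parallel e f) E"
  shows "card E \<le> max_nonparallel_unit_segments TYPE('d) (card S)"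
  unfolding max_nonparallel_unit_segments_def
proof (rule Max_ge)
  let ?X = "{card E' | (N :: real ^ 'd \<Rightarrow> real) S' E'.
      strictly_convex_norm N \<and> finite S' \<and> card S' = card S \<and>
      E' \<subseteq> unit_pairs N S' \<and> pairwise (\<lambda>e f. \<not> parallel e f) E'}"
  have "?X \<subseteq> {..card S choose 2}"
  proof
    fix x assume "x \<in> ?X"
    then obtain N' :: "real ^ 'd \<Rightarrow> real" and S' E' where *: "finite S'" "card S' = card S"
      "E' \<subseteq> unit_pairs N' S'" "x = card E'"
      by blast
    have "card E' \<le> card (unit_pairs N' S')"
      using *(3) by (intro card_mono) (auto simp: unit_pairs_eq_edge_pairs finite_edge_pairs *(1))
    also have "\<dots> \<le> card S' choose 2"
      unfolding unit_pairs_eq_edge_pairs using *(1) by (rule card_edge_pairs_le_choose)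
    finally show "x \<in> {..card S choose 2}" using *(2,4) by simp
  qed
  then show "finite ?X" by (rule finite_subset) simp
qed (use assms in blast)

lemma max_diameter_pairs_upper:
  fixes N :: "real ^ 'd::finite \<Rightarrow> real"
  assumes "strictly_convex_norm N" "finite S"
  shows "card (diameter_pairs N S) \<le> max_diameter_pairs TYPE('d) (card S)"
  unfolding max_diameter_pairs_def
proof (rule Max_ge)
  show "finite {card (diameter_pairs N S') | (N :: real ^ 'd \<Rightarrow> real) S'.
      strictly_convex_norm N \<and> finite S' \<and> card S' = card S}"
    by (rule finite_subset[of _ "{..card S choose 2}"])
       (auto simp: diameter_pairs_eq_edge_pairs intro: card_edge_pairs_le_choose[THEN order_trans])
qed (use assms in blast)

lemma exists_finite_vec_set: "\<exists>S :: (real ^ 'd::finite) set. finite S \<and> card S = n"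
  using infinite_arbitrarily_large[OF infinite_UNIV_char_0] by auto

lemma max_unit_pairs_le:
  assumes "\<And>(N :: real ^ 'd::finite \<Rightarrow> real) S. strictly_convex_norm N \<Longrightarrow> finite S \<Longrightarrow> card S = n \<Longrightarrow>
    card (unit_pairs N S) \<le> b"
  shows "max_unit_pairs TYPE('d) n \<le> b"
  unfolding max_unit_pairs_def
proof (rule Max.boundedI)
  show "finite {card (unit_pairs N S) | (N :: real ^ 'd \<Rightarrow> real) S.
      strictly_convex_norm N \<and> finite S \<and> card S = n}"
    by (rule finite_subset[of _ "{..b}"]) (use assms in auto)
  show "{card (unit_pairs N S) | (N :: real ^ 'd \<Rightarrow> real) S.
      strictly_convex_norm N \<and> finite S \<and> card S = n} \<noteq> {}"
    using exists_finite_vec_set[of n] strictly_convex_norm_norm by blast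
qed (use assms in auto)

lemma max_nonparallel_unit_segments_le_max_unit_pairs:
  "max_nonparallel_unit_segments TYPE('d::finite) n \<le> max_unit_pairs TYPE('d) n"
  unfolding max_nonparallel_unit_segments_def
proof (rule Max.boundedI)
  let ?X = "{card E | (N :: real ^ 'd \<Rightarrow> real) S E. strictly_convex_norm N \<and> finite S \<and> card S = n \<and>
    E \<subseteq> unit_pairs N S \<and> pairwise (\<lambda>e f. \<not> parallel e f) E}"
  show le: "x \<le> max_unit_pairs TYPE('d) n" if "x \<in> ?X" for x
  proof -
    obtain N :: "real ^ 'd \<Rightarrow> real" and S E where *: "strictly_convex_norm N" "finite S" "card S = n"
      "E \<subseteq> unit_pairs N S" "x = card E"
      using \<open>x \<in> ?X\<close> by blast
    have "card E \<le> card (unit_pairs N S)"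
      using *(4) by (intro card_mono) (auto simp: unit_pairs_eq_edge_pairs finite_edge_pairs *(2))
    also have "\<dots> \<le> max_unit_pairs TYPE('d) n"
      using max_unit_pairs_upper[OF *(1,2)] *(3) by simp
    finally show ?thesis using *(5) by simp
  qed
  then have "?X \<subseteq> {..max_unit_pairs TYPE('d) n}" by (intro subsetI) (simp only: atMost_iff)
  then show "finite ?X" by (rule finite_subset) simp
  obtain S :: "(real ^ 'd) set" where "finite S" "card S = n" using exists_finite_vec_set by blast
  then show "?X \<noteq> {}"
    using strictly_convex_norm_norm pairwise_empty[of "\<lambda>e f. \<not> parallel e f"] by blast
qed

text \<open>Dividing the norm by the diameter turns diameter pairs into unit pairs of a set of
  diameter 1, and these are pairwise nonparallel. The existence of a diameter pair guarantees that
  the diameter is positive.\<close>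

lemma max_diameter_pairs_le_max_nonparallel_unit_segments:
  "max_diameter_pairs TYPE('d::finite) n \<le> max_nonparallel_unit_segments TYPE('d) n"
  unfolding max_diameter_pairs_def
proof (rule Max.boundedI)
  let ?X = "{card (diameter_pairs N S) | (N :: real ^ 'd \<Rightarrow> real) S.
    strictly_convex_norm N \<and> finite S \<and> card S = n}"
  show "x \<le> max_nonparallel_unit_segments TYPE('d) n" if "x \<in> ?X" for x
  proof -
    obtain N :: "real ^ 'd \<Rightarrow> real" and S where *: "strictly_convex_norm N" "finite S" "card S = n"
      "x = card (diameter_pairs N S)"
      using \<open>x \<in> ?X\<close> by blast
    note N = strictly_convex_norm_imp_is_norm[OF *(1)]
    show ?thesis
    proof (cases "diameter_pairs N S = {}")
      case False
      then obtain a b where ab: "a \<in> S" "b \<in> S" "a \<noteq> b" unfolding diameter_pairs_def by blast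
      define D where "D = norm_diameter N S"
      have "0 < N (a - b)" using ab(3) by (intro is_norm_pos[OF N]) simp
      then have D: "0 < D" unfolding D_def using norm_diameter_upper[OF *(2) ab(1,2), of N] by linarith
      let ?N = "\<lambda>x. N x / D"
      have N': "strictly_convex_norm ?N" using *(1) D by (rule strictly_convex_norm_rescale)
      have "pairwise (\<lambda>e f. \<not> parallel e f) (unit_pairs ?N S)"
        using N' by (rule pairwise_nonparallel_unit_pairs)
          (use D norm_diameter_upper[OF *(2), of _ _ N] in \<open>simp add: D_def\<close>)
      then have "card (unit_pairs ?N S) \<le> max_nonparallel_unit_segments TYPE('d) n"
        using max_nonparallel_unit_segments_upper[OF N' *(2)] *(3) by auto
      then show ?thesis using *(4) diameter_pairs_eq_unit_pairs D unfolding D_def by metis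
    qed (use *(4) in simp)
  qed
  then have "?X \<subseteq> {..max_nonparallel_unit_segments TYPE('d) n}"
    by (intro subsetI) (simp only: atMost_iff)
  then show "finite ?X" by (rule finite_subset) simp
  show "?X \<noteq> {}" using exists_finite_vec_set[of n] strictly_convex_norm_norm by blast
qed

section \<open>Upper bound for unit distances\<close>

lemma antipodal_family_of_multipartite_unit_distances:
  fixes N :: "'a::euclidean_space \<Rightarrow> real"
  assumes "strictly_convex_norm N" "finite S" "2 \<le> r"
    and "has_complete_multipartite (\<lambda>x y. N (x - y) = 1) S r (5 ^ DIM('a) * m + 1)"
  shows "\<exists>A :: nat \<Rightarrow> 'a set. strictly_antipodal {..<r} A \<and> (\<forall>i<r. m \<le> card (A i))"
proof -
  note N = strictly_convex_norm_imp_is_norm[OF assms(1)]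
  obtain B where B0: "(\<forall>i<r. B i \<subseteq> S \<and> 5 ^ DIM('a) * m + 1 \<le> card (B i)) \<and>
      (\<forall>i<r. \<forall>j<r. i \<noteq> j \<longrightarrow> (\<forall>x\<in>B i. \<forall>y\<in>B j. N (x - y) = 1))"
    using assms(4) unfolding has_complete_multipartite_def ..
  then have B: "\<And>i. i < r \<Longrightarrow> B i \<subseteq> S" "\<And>i. i < r \<Longrightarrow> 5 ^ DIM('a) * m + 1 \<le> card (B i)"
    "\<And>i j x y. i < r \<Longrightarrow> j < r \<Longrightarrow> i \<noteq> j \<Longrightarrow> x \<in> B i \<Longrightarrow> y \<in> B j \<Longrightarrow> N (x - y) = 1"
    by simp_all
  \<comment> \<open>Since \<open>r \<ge> 2\<close>, each part lies on the unit sphere about a point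
    \<open>q\<close> of another part, so packing leaves at least \<open>m\<close> of its points at
    mutual distance at most 1.\<close>
  have "\<exists>C\<subseteq>B i. m \<le> card C \<and> (\<forall>x\<in>C. \<forall>y\<in>C. N (x - y) \<le> 1)" if i: "i < r" for i
  proof -
    obtain j where j: "j < r" "j \<noteq> i"
      using assms(3) by (cases "i = 0") (auto intro: that[of 0] that[of 1])
    then have "B j \<noteq> {}" using B(2)[of j] by auto
    then obtain q where q: "q \<in> B j" by blast
    show ?thesis
    proof (rule large_subset_of_small_diameter[OF N])
      show "finite (B i)" using B(1)[OF i] assms(2) finite_subset by blast
      show "N (x - q) \<le> 1" if "x \<in> B i" for x using B(3)[OF i j(1)] j(2) q that by simp
      show "5 ^ DIM('a) * m < card (B i)" using B(2)[OF i] by simp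
    qed
  qed
  then obtain C where C: "\<And>i. i < r \<Longrightarrow> C i \<subseteq> B i \<and> m \<le> card (C i) \<and> (\<forall>x\<in>C i. \<forall>y\<in>C i. N (x - y) \<le> 1)"
    by metis
  have "strictly_antipodal {..<r} C"
  proof (rule strictly_antipodal_of_unit_distances[OF assms(1)])
    fix i j p q assume "i \<in> {..<r}" "j \<in> {..<r}" "i \<noteq> j" "p \<in> C i" "q \<in> C j"
    then show "N (p - q) = 1" using B(3)[of i j p q] C[of i] C[of j] by auto
  qed (use C in auto)
  then show ?thesis using C by (intro exI[of _ C]) auto
qed

text \<open>By maximality of \<open>k\<close>, for some \<open>m\<close> no strictly antipodal
  family has \<open>Suc k\<close> members of size at least \<open>m\<close>. Hence no unit distance
  graph contains a complete \<open>Suc k\<close>-partite graph with parts of size \<open>?t\<close>,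
  and every vertex set of more than \<open>s\<close> points has a vertex of small degree. The
  threshold \<open>s\<close> is the same for all norms and point sets.\<close>

lemma max_unit_pairs_bound:
  fixes \<epsilon> :: real
  assumes "0 < \<epsilon>" "\<epsilon> < 1" and k: "k = antipodal_number TYPE('d::finite)"
  shows "\<exists>s. \<forall>n. real (max_unit_pairs TYPE('d) n)
    \<le> real s ^ 2 + (1 - (1 - \<epsilon>) / real k) * real n * (real n + 1) / 2"
proof -
  have k1: "1 \<le> k" using antipodal_number_greatest(3) k by blast
  have "\<not> has_large_antipodal_families TYPE('d) (Suc k)"
    using antipodal_number_greatest(2) k by fastforce
  then obtain m where m: "\<And>A :: nat \<Rightarrow> (real ^ 'd) set. strictly_antipodal {..<Suc k} A \<Longrightarrow>
      \<not> (\<forall>i<Suc k. m \<le> card (A i))"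
    unfolding has_large_antipodal_families_def by blast
  let ?t = "5 ^ DIM(real ^ 'd) * m + 1"
  obtain s where s: "\<forall>(V :: (real ^ 'd) set) E. finite V \<longrightarrow> s \<le> card V \<longrightarrow> symp E \<longrightarrow>
    (\<forall>v\<in>V. real k * real (card {u \<in> V. \<not> E v u}) \<le> (1 - \<epsilon>) * real (card V)) \<longrightarrow>
    has_complete_multipartite E V (Suc k) ?t"
    using complete_multipartite_of_large_degrees[OF assms(1), of k ?t] by (elim exE)
  \<comment> \<open>This is the proportion of neighbours left when more than
    \<open>(1 - \<epsilon>) * card V / k\<close> vertices of \<open>V\<close> are
    non-neighbours.\<close>
  define \<alpha> where "\<alpha> = 1 - (1 - \<epsilon>) / real k"
  have \<alpha>0: "0 \<le> \<alpha>" using k1 assms(1,2) by (simp add: \<alpha>_def field_simps)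
  have main: "real (card (unit_pairs N S)) \<le> real s ^ 2 + \<alpha> * real (card S) * (real (card S) + 1) / 2"
    if N: "strictly_convex_norm N" and S: "finite S" for N :: "real ^ 'd \<Rightarrow> real" and S
  proof -
    let ?E = "\<lambda>x y. N (x - y) = 1"
    have symE: "symp ?E"
      using is_norm_minus_commute[OF strictly_convex_norm_imp_is_norm[OF N]] by (auto intro: sympI)
    show ?thesis
      unfolding unit_pairs_eq_edge_pairs
    proof (rule card_edge_pairs_le_of_small_degrees[OF S symE \<alpha>0])
      fix V assume V: "V \<subseteq> S" "s < card V"
      have finV: "finite V" using V(1) S finite_subset by blast
      have "\<not> has_complete_multipartite ?E V (Suc k) ?t"
        using antipodal_family_of_multipartite_unit_distances[OF N finV, of "Suc k" m] m k1 by auto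
      then have "\<not> (\<forall>v\<in>V. real k * real (card {u \<in> V. \<not> ?E v u}) \<le> (1 - \<epsilon>) * real (card V))"
        using s[THEN spec, of V, THEN spec, of ?E] finV V(2) symE by simp
      then obtain v where v: "v \<in> V" "(1 - \<epsilon>) * real (card V) < real k * real (card {u \<in> V. \<not> ?E v u})"
        by force
      have "card V = card {u \<in> V. ?E v u} + card {u \<in> V. \<not> ?E v u}"
        using card_Int_Diff[OF finV, of "{u. ?E v u}"] by (simp add: Int_def set_diff_eq)
      then have "real (card {u \<in> V. ?E v u}) = real (card V) - real (card {u \<in> V. \<not> ?E v u})"
        by simp
      also have "\<dots> \<le> real (card V) - (1 - \<epsilon>) * real (card V) / real k"
        using v(2) k1 by (simp add: field_simps)
      also have "\<dots> = \<alpha> * real (card V)" by (simp add: \<alpha>_def algebra_simps)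
      finally show "\<exists>v\<in>V. real (card {u \<in> V. ?E v u}) \<le> \<alpha> * real (card V)" using v(1) by blast
    qed
  qed
  \<comment> \<open>The maximum is a natural number, so the real bound passes through its floor;
    nonnegativity allows the return to the reals.\<close>
  have "max_unit_pairs TYPE('d) n \<le> nat \<lfloor>real s ^ 2 + \<alpha> * real n * (real n + 1) / 2\<rfloor>" for n
  proof (rule max_unit_pairs_le)
    fix N :: "real ^ 'd \<Rightarrow> real" and S :: "(real ^ 'd) set"
    assume "strictly_convex_norm N" "finite S" "card S = n"
    then show "card (unit_pairs N S) \<le> nat \<lfloor>real s ^ 2 + \<alpha> * real n * (real n + 1) / 2\<rfloor>"
      using main[of N S] by (intro le_nat_floor) simp
  qed
  moreover have "0 \<le> real s ^ 2 + \<alpha> * real n * (real n + 1) / 2" for n using \<alpha>0 by simp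
  ultimately have "real (max_unit_pairs TYPE('d) n) \<le> real s ^ 2 + \<alpha> * real n * (real n + 1) / 2" for n
    by (metis of_nat_floor of_nat_mono order_trans)
  then show ?thesis unfolding \<alpha>_def by blast
qed

section \<open>Lower bound for diameters\<close>

lemma two_choose_two: "2 * (n choose 2) = n * (n - 1)"
  unfolding choose_two by (rule dvd_mult_div_cancel) auto

text \<open>In the norm built from \<open>k\<close> antipodal sets, choose
  \<open>m = n div k\<close> points from each. All cross pairs have length 1 and no distance exceeds
  1, so at least \<open>(k * m choose 2) - k * (m choose 2)\<close> pairs are diameters; this is the
  complete \<open>k\<close>-partite count. Antipodal sets of \<open>n\<close> points leave room to
  complete the choice to exactly \<open>n\<close> points.\<close>

lemma max_diameter_pairs_lower:
  assumes k: "k = antipodal_number TYPE('d::finite)" and "2 \<le> k" and n: "k \<le> n" "3 \<le> n"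
  shows "real (n div k) ^ 2 * (real k ^ 2 - real k) / 2 \<le> real (max_diameter_pairs TYPE('d) n)"
proof -
  have "has_large_antipodal_families TYPE('d) k" using antipodal_number_greatest(1) k by blast
  then obtain A0 :: "nat \<Rightarrow> (real ^ 'd) set" where A0: "strictly_antipodal {..<k} A0"
    "\<And>i. i < k \<Longrightarrow> infinite (A0 i) \<or> n \<le> card (A0 i)"
    using has_large_antipodal_familiesD[of "TYPE('d)" k n] n(2) by auto
  have "\<exists>B\<subseteq>A0 i. finite B \<and> card B = n" if "i < k" for i
    using A0(2)[OF that] by (rule finite_subset_of_size)
  then obtain A where A: "\<And>i. i < k \<Longrightarrow> A i \<subseteq> A0 i \<and> finite (A i) \<and> card (A i) = n"
    by metis
  have anti: "strictly_antipodal {..<k} A"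
    using A0(1) by (rule strictly_antipodal_mono) (use A in auto)
  let ?U = "\<Union>i<k. A i"
  have finU: "finite ?U" using A by auto
  have cU: "n \<le> card ?U" using card_mono[OF finU, of "A 0"] A[of 0] assms(2) by force
  have ne: "A i \<noteq> {}" if "i < k" for i using A[OF that] n by auto
  obtain N where N: "strictly_convex_norm N"
    "\<forall>i\<in>{..<k}. \<forall>j\<in>{..<k}. i \<noteq> j \<longrightarrow> (\<forall>p\<in>A i. \<forall>q\<in>A j. N (p - q) = 1)"
    "\<forall>r\<in>?U. \<forall>s\<in>?U. N (r - s) \<le> 1"
    using strictly_convex_norm_of_strictly_antipodal[OF anti finU, of 0 1] cU n ne assms(2) by auto
  note norm = strictly_convex_norm_imp_is_norm[OF N(1)]
  define m where "m = n div k"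
  have m: "1 \<le> m" "m \<le> n" "k * m \<le> n"
    unfolding m_def using assms(2) n by (simp_all add: Suc_le_eq div_greater_zero_iff)
  have "\<exists>B\<subseteq>A i. finite B \<and> card B = m" if "i < k" for i
    using A[OF that] m(2) by (intro finite_subset_of_size) simp
  then obtain B where B: "\<And>i. i < k \<Longrightarrow> B i \<subseteq> A i \<and> finite (B i) \<and> card (B i) = m"
    by metis
  have cross: "N (x - y) = 1" if "i < k" "j < k" "i \<noteq> j" "x \<in> B i" "y \<in> B j" for i j x y
    using that B[of i] B[of j] N(2) by blast
  define T where "T = (\<Union>i<k. B i)"
  have finT: "finite T" unfolding T_def using B by auto
  \<comment> \<open>A common point would be at distance 1 from itself.\<close>
  have "B i \<inter> B j = {}" if "i < k" "j < k" "i \<noteq> j" for i j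
    using cross[OF that] is_norm_eq_0_iff[OF norm, of 0] by fastforce
  then have cT: "card T = k * m"
    unfolding T_def using B by (subst card_UN_disjoint) auto
  have "T \<subseteq> ?U" unfolding T_def using B by fastforce
  \<comment> \<open>The points beyond \<open>k * m\<close> come from \<open>?U\<close>, where all
    distances are at most 1, so they do not enlarge the diameter.\<close>
  then obtain S where S: "T \<subseteq> S" "S \<subseteq> ?U" "card S = n"
    using exists_subset_between[of T n ?U] cT m(3) cU finU by auto
  have finS: "finite S" using S(2) finU finite_subset by blast
  have "B i \<noteq> {}" if "i < k" for i using B[OF that] m(1) by auto
  from this[of 0] this[of 1] obtain x y where xy: "x \<in> B 0" "y \<in> B 1"
    using assms(2) by auto
  have "0 < k" "1 < k" using assms(2) by auto
  then have "x \<in> S" "y \<in> S" using xy S(1) unfolding T_def by blast+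
  moreover have unit: "N (x - y) = 1"
    using cross[OF \<open>0 < k\<close> \<open>1 < k\<close> _ xy] by simp
  moreover have "N (u - v) \<le> N (x - y)" if "u \<in> S" "v \<in> S" for u v
    unfolding unit using bspec[OF bspec[OF N(3) subsetD[OF S(2) that(1)]] subsetD[OF S(2) that(2)]] .
  ultimately have diam: "norm_diameter N S = 1"
    using norm_diameter_eq[OF finS, of x y N] by metis
  let ?X = "{e. e \<subseteq> T \<and> card e = 2}" and ?Y = "\<lambda>i. {e. e \<subseteq> B i \<and> card e = 2}"
  have "?X - (\<Union>i<k. ?Y i) \<subseteq> diameter_pairs N S"
  proof
    fix e assume e: "e \<in> ?X - (\<Union>i<k. ?Y i)"
    then obtain u v where uv: "e = {u, v}" "u \<noteq> v" by (auto simp: card_2_iff)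
    with e have "u \<in> T" "v \<in> T" by auto
    then obtain i j where ij: "i < k" "j < k" "u \<in> B i" "v \<in> B j" unfolding T_def by auto
    have "i \<noteq> j" using e uv ij by auto
    then have "N (u - v) = 1" using cross ij by blast
    then show "e \<in> diameter_pairs N S"
      unfolding diameter_pairs_def diam using uv \<open>u \<in> T\<close> \<open>v \<in> T\<close> S(1) by blast
  qed
  then have "card (?X - (\<Union>i<k. ?Y i)) \<le> card (diameter_pairs N S)"
    by (intro card_mono) (auto simp: diameter_pairs_eq_edge_pairs finite_edge_pairs finS)
  also have "\<dots> \<le> max_diameter_pairs TYPE('d) n"
    using max_diameter_pairs_upper[OF N(1) finS] S(3) by simp
  finally have le: "card (?X - (\<Union>i<k. ?Y i)) \<le> max_diameter_pairs TYPE('d) n" .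
  have "card (\<Union>i<k. ?Y i) \<le> (\<Sum>i<k. card (?Y i))" by (rule card_UN_le) simp
  also have "\<dots> = k * (m choose 2)" using B n_subsets[of "B _" 2] by simp
  finally have "card (\<Union>i<k. ?Y i) \<le> k * (m choose 2)" .
  moreover have "card ?X - card (\<Union>i<k. ?Y i) \<le> card (?X - (\<Union>i<k. ?Y i))"
    using B by (intro diff_card_le_card_Diff finite_UN_I) auto
  moreover have "card ?X = (k * m) choose 2" using n_subsets[OF finT, of 2] cT by simp
  ultimately have "(k * m) choose 2 \<le> max_diameter_pairs TYPE('d) n + k * (m choose 2)"
    using le by linarith
  \<comment> \<open>Doubling removes the division hidden in the binomials; positivity of
    \<open>m\<close> and \<open>k * m\<close> then makes the truncated subtractions exact over the
    reals.\<close>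
  then have "2 * ((k * m) choose 2) \<le> 2 * max_diameter_pairs TYPE('d) n + k * (2 * (m choose 2))"
    by (simp add: mult.left_commute[of k 2])
  then have "k * m * (k * m - 1) \<le> 2 * max_diameter_pairs TYPE('d) n + k * (m * (m - 1))"
    unfolding two_choose_two .
  then have "real (k * m * (k * m - 1)) \<le> real (2 * max_diameter_pairs TYPE('d) n + k * (m * (m - 1)))"
    by (rule of_nat_mono)
  moreover have "1 \<le> k * m" using m(1) assms(2) by simp
  ultimately have "real k * real m * (real k * real m - 1)
      \<le> 2 * real (max_diameter_pairs TYPE('d) n) + real k * (real m * (real m - 1))"
    using m(1) by (simp add: of_nat_diff)
  then show ?thesis unfolding m_def[symmetric] by (simp add: power2_eq_square algebra_simps)
qed

section \<open>Passage to the limit\<close>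

lemma max_diameter_pairs_lower_limit:
  assumes k: "k = antipodal_number TYPE('d::finite)"
  shows "\<exists>g. g \<longlonglongrightarrow> 1 / 2 * (1 - 1 / real k) \<and>
    (\<forall>\<^sub>F n in sequentially. g n \<le> real (max_diameter_pairs TYPE('d) n) / (real n)\<^sup>2)"
proof (cases "k = 1")
  case True
  \<comment> \<open>For \<open>k = 1\<close> the limit is 0, and the zero sequence bounds from
    below; the multipartite construction requires two members.\<close>
  then show ?thesis by (intro exI[of _ "\<lambda>_. 0"]) simp
next
  case False
  then have k2: "2 \<le> k" using antipodal_number_greatest(3)[of "TYPE('d)"] k by linarith
  let ?g = "\<lambda>n. (real (n div k) / real n)\<^sup>2 * ((real k)\<^sup>2 - real k) / 2"
  have "(\<lambda>n. real (n div k) / real n) \<longlonglongrightarrow> 1 / real k"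
  proof (rule tendsto_sandwich)
    show "\<forall>\<^sub>F n in sequentially. 1 / real k - 1 / real n \<le> real (n div k) / real n"
      using eventually_gt_at_top[of 0]
    proof eventually_elim
      case (elim n)
      have "real n / real k - 1 \<le> real (n div k)"
        using floor_divide_of_nat_eq[of n k, where 'a = real] by linarith
      then have "(real n / real k - 1) / real n \<le> real (n div k) / real n"
        by (rule divide_right_mono) simp
      then show ?case using elim by (simp add: diff_divide_distrib)
    qed
    show "\<forall>\<^sub>F n in sequentially. real (n div k) / real n \<le> 1 / real k"
      using eventually_gt_at_top[of 0]
    proof eventually_elim
      case (elim n)
      have "real (n div k) / real n \<le> real n / real k / real n"
        by (rule divide_right_mono[OF of_nat_div_le_of_nat]) simp
      then show ?case using elim by simp
    qed
    show "(\<lambda>n. 1 / real k - 1 / real n) \<longlonglongrightarrow> 1 / real k"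
      using tendsto_diff[OF tendsto_const lim_1_over_n] by simp
  qed simp
  then have "?g \<longlonglongrightarrow> (1 / real k)\<^sup>2 * ((real k)\<^sup>2 - real k) / 2"
    by (rule tendsto_divide[OF tendsto_mult[OF tendsto_power tendsto_const] tendsto_const]) simp
  moreover have "(1 / real k)\<^sup>2 * ((real k)\<^sup>2 - real k) / 2 = 1 / 2 * (1 - 1 / real k)"
    using k2 by (simp add: field_simps power2_eq_square)
  moreover have "\<forall>\<^sub>F n in sequentially. ?g n \<le> real (max_diameter_pairs TYPE('d) n) / (real n)\<^sup>2"
    using eventually_ge_at_top[of "max k 3"]
  proof eventually_elim
    case (elim n)
    have "real (n div k) ^ 2 * (real k ^ 2 - real k) / 2 / (real n)\<^sup>2
        \<le> real (max_diameter_pairs TYPE('d) n) / (real n)\<^sup>2"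
      using max_diameter_pairs_lower[OF k k2, of n] elim by (intro divide_right_mono) auto
    then show ?case by (simp add: power_divide)
  qed
  ultimately show ?thesis by (intro exI[of _ ?g]) simp
qed

lemma max_unit_pairs_upper_limit:
  assumes k: "k = antipodal_number TYPE('d::finite)" and a: "1 / 2 * (1 - 1 / real k) < a"
  shows "\<forall>\<^sub>F n in sequentially. real (max_unit_pairs TYPE('d) n) / (real n)\<^sup>2 < a"
proof -
  have k1: "1 \<le> k" using antipodal_number_greatest(3) k by blast
  \<comment> \<open>The minimum with 1/2 gives \<open>\<epsilon> < 1\<close>. Since
    \<open>\<alpha> / 2\<close> exceeds the limit by \<open>\<epsilon> / (2 * k)\<close>, which is
    less than \<open>\<epsilon>\<close>, it stays below \<open>a\<close>.\<close>
  define \<epsilon> where "\<epsilon> = min (1 / 2) (a - 1 / 2 * (1 - 1 / real k))"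
  have \<epsilon>: "0 < \<epsilon>" "\<epsilon> < 1" "\<epsilon> \<le> a - 1 / 2 * (1 - 1 / real k)"
    using a by (auto simp: \<epsilon>_def)
  define \<alpha> where "\<alpha> = 1 - (1 - \<epsilon>) / real k"
  have "\<epsilon> / real k \<le> \<epsilon> / 1" using \<epsilon>(1) k1 by (intro divide_left_mono) auto
  then have \<alpha>: "\<alpha> / 2 < a" using \<epsilon>(1,3) by (simp add: \<alpha>_def diff_divide_distrib)
  obtain s where s: "\<And>n. real (max_unit_pairs TYPE('d) n)
      \<le> real s ^ 2 + \<alpha> * real n * (real n + 1) / 2"
    using max_unit_pairs_bound[OF \<epsilon>(1,2) k] unfolding \<alpha>_def by blast
  have "(\<lambda>n. (real s * (1 / real n))\<^sup>2 + \<alpha> * (1 + 1 / real n) / 2)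
      \<longlonglongrightarrow> (real s * 0)\<^sup>2 + \<alpha> * (1 + 0) / 2"
    by (intro tendsto_divide tendsto_add tendsto_mult tendsto_power tendsto_const lim_1_over_n) simp
  then have "\<forall>\<^sub>F n in sequentially. (real s * (1 / real n))\<^sup>2 + \<alpha> * (1 + 1 / real n) / 2 < a"
    using \<alpha> by (intro order_tendstoD(2)) auto
  then show ?thesis
    using eventually_gt_at_top[of 0]
  proof eventually_elim
    case (elim n)
    have "real (max_unit_pairs TYPE('d) n) / (real n)\<^sup>2
        \<le> (real s ^ 2 + \<alpha> * real n * (real n + 1) / 2) / (real n)\<^sup>2"
      by (rule divide_right_mono[OF s]) simp
    also have "\<dots> = (real s * (1 / real n))\<^sup>2 + \<alpha> * (1 + 1 / real n) / 2"
      using elim(2) by (simp add: field_simps power2_eq_square)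
    finally show ?case using elim(1) by linarith
  qed
qed

theorem theorem8:
  assumes "CARD('d::finite) \<ge> 3"
  shows
    "(\<lambda>n. real (max_nonparallel_unit_segments TYPE('d) n) / (real n)^2)
        \<longlonglongrightarrow> 1 / 2 * (1 - 1 / real (antipodal_number TYPE('d)))
     \<and> (\<lambda>n. real (max_unit_pairs TYPE('d) n) / (real n)^2)
        \<longlonglongrightarrow> 1 / 2 * (1 - 1 / real (antipodal_number TYPE('d)))
     \<and> (\<lambda>n. real (max_diameter_pairs TYPE('d) n) / (real n)^2)
        \<longlonglongrightarrow> 1 / 2 * (1 - 1 / real (antipodal_number TYPE('d)))"
proof -
  let ?L = "1 / 2 * (1 - 1 / real (antipodal_number TYPE('d)))"
  obtain g where g: "g \<longlonglongrightarrow> ?L"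
    "\<forall>\<^sub>F n in sequentially. g n \<le> real (max_diameter_pairs TYPE('d) n) / (real n)\<^sup>2"
    using max_diameter_pairs_lower_limit[OF refl] by blast
  \<comment> \<open>One squeeze serves all three sequences: diameters bound each from below and unit
    distances bound each from above.\<close>
  have squeeze: "(\<lambda>n. real (f n) / (real n)\<^sup>2) \<longlonglongrightarrow> ?L"
    if f: "\<And>n. max_diameter_pairs TYPE('d) n \<le> f n" "\<And>n. f n \<le> max_unit_pairs TYPE('d) n" for f
  proof (rule order_tendstoI)
    fix a assume "a < ?L"
    with g(1) have "\<forall>\<^sub>F n in sequentially. a < g n" by (rule order_tendstoD(1))
    with g(2) show "\<forall>\<^sub>F n in sequentially. a < real (f n) / (real n)\<^sup>2"
    proof eventually_elim
      case (elim n)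
      have "real (max_diameter_pairs TYPE('d) n) / (real n)\<^sup>2 \<le> real (f n) / (real n)\<^sup>2"
        using f(1) by (intro divide_right_mono) auto
      then show ?case using elim by linarith
    qed
  next
    fix a assume "?L < a"
    then have "\<forall>\<^sub>F n in sequentially. real (max_unit_pairs TYPE('d) n) / (real n)\<^sup>2 < a"
      by (rule max_unit_pairs_upper_limit[OF refl])
    then show "\<forall>\<^sub>F n in sequentially. real (f n) / (real n)\<^sup>2 < a"
    proof eventually_elim
      case (elim n)
      have "real (f n) / (real n)\<^sup>2 \<le> real (max_unit_pairs TYPE('d) n) / (real n)\<^sup>2"
        using f(2) by (intro divide_right_mono) auto
      then show ?case using elim by linarith
    qed
  qed
  note D_le_W = max_diameter_pairs_le_max_nonparallel_unit_segments[where 'd = 'd]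
  note W_le_U = max_nonparallel_unit_segments_le_max_unit_pairs[where 'd = 'd]
  show ?thesis
    using D_le_W W_le_U order_trans[OF D_le_W W_le_U] by (intro conjI squeeze) auto
qed

end
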